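(* Suppose there is a real $\nu>0$ such that for every $\varepsilon>0$ there is a constant $C_\varepsilon$ with $$E_4(r,j,M,H)\leqslant C_\varepsilon H^{2-\nu}M^2\left(\frac{H^3M^2}{r}+HM\right)r^{\varepsilon}$$ whenever $r,j\in\mathbb{N}$, $\gcd(r,j)=1$ and $1\leqslant H\leqslant M\leqslant r$. Then there exist $\eta>0$ and a constant $C>0$ such that for all real $Q\geqslant 1$, $N=Q^3$, all $M\in\mathbb{R}$ and all sequences $(a_n)_{M<n\leqslant M+N}$ of complex numbers, $$\sum_{q\leqslant Q}\ \sum_{\substack{a=1\\ \gcd(q,a)=1}}^{q^2}\left|\sum_{M<n\leqslant M+N}a_n e\left(\frac{na}{q^2}\right)\right|^2\leqslant C\,Q^{1/2-\eta}NZ,\qquad Z:=\sum_{M<n\leqslant M+N}|a_n|^2.$$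
   Context: $e(x)=e^{2\pi i x}$; $q$ runs over positive integers and $n$ over integers. A modular square root of $s$ modulo $r$ is a residue $k$ modulo $r$ with $k^2\equiv s\pmod r$. $E_4(r,j,M,H)$ is the number of tuples $(m_1,\dots,m_8,k_1,\dots,k_8)$ with integers $1\leqslant m_i\leqslant M$, residues $k_i$ modulo $r$ with $k_i^2\equiv jm_i\pmod r$, $1\leqslant|m_i-m_{i+1}|\leqslant H$ for $i=1,3,5,7$, and $k_1-k_2+k_3-k_4\equiv k_5-k_6+k_7-k_8\pmod r$. *)

theory Defs
  imports "HOL-Analysis.Analysis" "HOL-Number_Theory.Cong" "HOL-Library.FuncSet"
begin

definition e :: "real \<Rightarrow> complex" where
  "e x = exp (2 * of_real pi * \<i> * of_real x)"

text \<open>Residues modulo \<open>r\<close> are represented by the integers \<open>0, \<dots>, r - 1\<close>.\<close>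

definition modular_sqrts :: "nat \<Rightarrow> int \<Rightarrow> int set" where
  "modular_sqrts r s = {k \<in> {0..<int r}. [k\<^sup>2 = s] (mod int r)}"

text \<open>The tuples \<open>(m\<^sub>1, \<dots>, m\<^sub>8)\<close> and \<open>(k\<^sub>1, \<dots>, k\<^sub>8)\<close> are extensional functions on \<open>{1..8}\<close>,
  so that distinct elements are distinct tuples and the set is finite.\<close>

definition E4_tuples :: "nat \<Rightarrow> nat \<Rightarrow> real \<Rightarrow> real \<Rightarrow> ((nat \<Rightarrow> int) \<times> (nat \<Rightarrow> int)) set" where
  "E4_tuples r j M H =
     {(m, k). m \<in> {1..8} \<rightarrow>\<^sub>E {x. 1 \<le> x \<and> real_of_int x \<le> M}
        \<and> k \<in> (\<Pi>\<^sub>E i\<in>{1..8}. modular_sqrts r (int j * m i))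
        \<and> (\<forall>i\<in>{1, 3, 5, 7}. 1 \<le> \<bar>m i - m (i + 1)\<bar> \<and> real_of_int \<bar>m i - m (i + 1)\<bar> \<le> H)
        \<and> [k 1 - k 2 + k 3 - k 4 = k 5 - k 6 + k 7 - k 8] (mod int r)}"

definition E4 :: "nat \<Rightarrow> nat \<Rightarrow> real \<Rightarrow> real \<Rightarrow> nat" where
  "E4 r j M H = card (E4_tuples r j M H)"

end

theory Submission
  imports Defs "HOL-Computational_Algebra.Primes"
begin

text \<open>By the large sieve it suffices to show that any \<open>\<alpha>\<close> has at most \<open>C Q\<^sup>1\<^sup>/\<^sup>2\<^sup>-\<^sup>\<eta>\<close> reduced
  fractions \<open>a/q\<^sup>2\<close>, \<open>q \<le> Q\<close>, within \<open>Q\<^sup>-\<^sup>3\<close>. Take by Dirichlet \<open>\<alpha> = b/r + z\<close> with \<open>r \<le> R = Q\<^sup>3\<^sup>/\<^sup>2\<^sup>+\<^sup>\<delta>\<close> and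
  \<open>r |z| \<le> 2/R\<close>, and attach to \<open>a/q\<^sup>2\<close> the integer \<open>m = a r - b q\<^sup>2\<close>: then \<open>q\<close> is a square root of \<open>j m\<close>
  modulo \<open>r\<close> for a fixed \<open>j\<close>, and all \<open>q\<close> with the same \<open>m \<noteq> 0\<close> lie in an interval of length \<open>3 r\<close>.
  If \<open>r \<le> Q\<^sup>3\<^sup>/\<^sup>2\<^sup>-\<^sup>\<delta>\<close>, there are only \<open>O(Q\<^sup>1\<^sup>/\<^sup>2\<^sup>-\<^sup>\<delta>)\<close> values of \<open>m\<close>, and the divisor bound finishes.
  Otherwise \<open>|m| \<le> M = 3 Q\<^sup>1\<^sup>/\<^sup>2\<^sup>+\<^sup>\<delta>\<close> and the roots \<open>q\<close> are themselves at most \<open>Q < r\<close>, so that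
  \<open>P\<close> such fractions force \<open>E\<^sub>4(r, j, M, M)\<close> to be at least of order \<open>P\<^sup>8 / Q\<close>; the hypothesis with \<open>H = M\<close> bounds it by about
  \<open>Q\<^sup>3\<^sup>-\<^sup>\<nu>\<^sup>/\<^sup>2\<close>.\<close>

section \<open>Divisors and square roots modulo \<open>r\<close>\<close>

lemma card_divisors_prime_power_mult:
  fixes p n a :: nat
  assumes "prime p" "n > 0"
  shows "card {d. d dvd p ^ a * n} \<le> (a + 1) * card {d. d dvd n}"
proof -
  have fin: "finite {d. d dvd n}" using assms by auto
  have "{d. d dvd p ^ a * n} \<subseteq> (\<lambda>(i, d). p ^ i * d) ` ({..a} \<times> {d. d dvd n})"
  proof
    fix d assume "d \<in> {d. d dvd p ^ a * n}"
    then obtain x y where "d = x * y" "x dvd p ^ a" "y dvd n"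
      by (auto elim: dvd_productE)
    with assms show "d \<in> (\<lambda>(i, d). p ^ i * d) ` ({..a} \<times> {d. d dvd n})"
      by (auto simp: divides_primepow_nat image_iff) 
  qed
  then have "card {d. d dvd p ^ a * n} \<le> card ({..a} \<times> {d. d dvd n})"
    using fin by (intro surj_card_le) auto
  then show ?thesis by (simp add: card_cartesian_product)
qed

text \<open>Price of a small prime in the divisor bound: the factor \<open>a + 1\<close> contributed
  by \<open>p ^ a\<close> is absorbed by \<open>p powr (\<epsilon> * a)\<close> up to a constant. It
  follows from \<open>exp x \<ge> 1 + x\<close> and \<open>ln 2 \<ge> 1/2\<close>.\<close>

lemma linear_le_exp2:
  fixes \<epsilon> :: real
  assumes "\<epsilon> > 0" 
  shows "real a + 1 \<le> (1 + 2 / \<epsilon>) * 2 powr (\<epsilon> * real a)"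
proof -
  have l2: "ln 2 \<ge> (1/2::real)" using ln_ge_iff[of 2 "1/2"] exp_half_le2 by simp
  have "1 + \<epsilon> * real a * ln 2 \<le> 2 powr (\<epsilon> * real a)"
    using exp_ge_add_one_self[of "\<epsilon> * real a * ln 2"] by (simp add: powr_def)
  moreover have "\<epsilon> * real a * (1/2) \<le> \<epsilon> * real a * ln 2"
    using l2 assms by (intro mult_left_mono) auto
  ultimately have *: "1 + \<epsilon> * real a / 2 \<le> 2 powr (\<epsilon> * real a)" by simp
  have "real a + 1 \<le> (1 + 2 / \<epsilon>) * (1 + \<epsilon> * real a / 2)"
    using assms by (simp add: field_simps)
  also have "\<dots> \<le> (1 + 2 / \<epsilon>) * 2 powr (\<epsilon> * real a)"
    using * assms by (intro mult_left_mono) auto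
  finally show ?thesis .
qed

text \<open>Induction strips off the full power \<open>p ^ a\<close> of one prime. If
  \<open>p \<ge> K\<close>, then \<open>p powr \<epsilon> \<ge> 2\<close> and
  \<open>a + 1 \<le> 2 ^ a\<close> is absorbed at no cost; only a prime below \<open>K\<close> costs
  a factor \<open>1 + 2 / \<epsilon>\<close>.\<close>

lemma card_divisors_le_prime_factors:
  fixes \<epsilon> K :: real
  assumes "\<epsilon> > 0" "K powr \<epsilon> \<ge> 2" "K > 0" "n > 0"
  shows "real (card {d. d dvd n}) \<le>
           (1 + 2 / \<epsilon>) ^ card {p \<in> prime_factors n. real p < K} * real n powr \<epsilon>"
  using assms(4)
proof (induction n rule: less_induct)
  case (less n)
  show ?case
  proof (cases "n = 1")
    case True
    then show ?thesis by (simp add: )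
  next
    case False
    then obtain p where p: "prime p" "p dvd n" using prime_factor_nat by blast
    define a where "a = multiplicity p n"
    have a: "a > 0" unfolding a_def using p less.prems by (simp add: prime_multiplicity_gt_zero_iff)
    obtain m where m: "n = p ^ a * m" "\<not> p dvd m"
      using multiplicity_decompose'[of n p] p less.prems unfolding a_def by (metis not_prime_unit gr_implies_not0)
    have m0: "m > 0" using m less.prems by (cases "m = 0") auto
    have p2: "p \<ge> 2" using p prime_ge_2_nat by blast
    have "p ^ a > 1" using p2 a by (metis One_nat_def le_less_trans less_2_cases_iff not_less one_less_power less_le_trans nat_less_le)
    then have mn: "m < n" using m m0 by simp
    have pf: "prime_factors n = insert p (prime_factors m)"
      using m m0 p a by (simp add: prime_factors_product prime_factorization_prime_power)
    have pm: "p \<notin> prime_factors m" using m by auto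
    define B where "B = 1 + 2 / \<epsilon>"
    have B1: "B \<ge> 1" using assms unfolding B_def by simp
    have pa: "real (p ^ a) powr \<epsilon> = real p powr (\<epsilon> * real a)"
      using p2 powr_realpow[of "real p" a] by (metis mult.commute of_nat_0_less_iff of_nat_power p(1) powr_powr prime_gt_0_nat)
    let ?c = "\<lambda>n. card {p \<in> prime_factors n. real p < K}"
    have step: "real (a + 1) * B ^ ?c m \<le> B ^ ?c n * real (p ^ a) powr \<epsilon>"
    proof (cases "real p < K")
      case True
      have "{q \<in> prime_factors n. real q < K} = insert p {q \<in> prime_factors m. real q < K}"
        using pf True by auto
      then have c: "?c n = Suc (?c m)" using pm by simp
      have "real (a + 1) \<le> B * 2 powr (\<epsilon> * real a)"
        using linear_le_exp2[OF assms(1), of a] unfolding B_def by simp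
      also have "\<dots> \<le> B * real p powr (\<epsilon> * real a)"
        using p2 B1 assms(1) by (intro mult_left_mono powr_mono2) auto
      also have "real p powr (\<epsilon> * real a) = real (p ^ a) powr \<epsilon>"
        by (rule pa[symmetric])
      finally show ?thesis using B1 by (simp add: c mult_right_mono mult.assoc mult.left_commute)
    next
      case False
      then have "{q \<in> prime_factors n. real q < K} = {q \<in> prime_factors m. real q < K}"
        using pf by auto
      then have c: "?c n = ?c m" by simp
      have "a + 1 \<le> 2 ^ a" by (induction a) auto
      then have "real (a + 1) \<le> 2 ^ a" by (metis of_nat_le_iff of_nat_numeral of_nat_power)
      also have "(2::real) ^ a \<le> (real p powr \<epsilon>) ^ a"
      proof (rule power_mono)
        have "2 \<le> K powr \<epsilon>" by fact
        also have "\<dots> \<le> real p powr \<epsilon>" using False assms by (intro powr_mono2) auto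
        finally show "2 \<le> real p powr \<epsilon>" .
      qed simp
      also have "\<dots> = real (p ^ a) powr \<epsilon>"
        unfolding pa using p2 by (subst powr_powr[symmetric], subst powr_realpow) auto
      finally show ?thesis using B1 by (simp add: c mult_left_mono mult.commute)
    qed
    have "real (card {d. d dvd n}) \<le> real (a + 1) * real (card {d. d dvd m})"
      using card_divisors_prime_power_mult[OF p(1) m0, of a] m(1)
      by (metis of_nat_le_iff of_nat_mult)
    also have "\<dots> \<le> real (a + 1) * (B ^ ?c m * real m powr \<epsilon>)"
      using less.IH[OF mn m0] unfolding B_def by (intro mult_left_mono) auto
    also have "\<dots> \<le> (B ^ ?c n * real (p ^ a) powr \<epsilon>) * real m powr \<epsilon>"
      using step by (simp add: mult_right_mono mult.assoc[symmetric] del: of_nat_add of_nat_power)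
    also have "\<dots> = B ^ ?c n * real n powr \<epsilon>"
      by (simp add: m(1) powr_mult)
    finally show ?thesis unfolding B_def .
  qed
qed

theorem card_divisors_le_powr:
  fixes \<epsilon> :: real
  assumes "\<epsilon> > 0"
  obtains C where "C \<ge> 1" "\<And>n. n > 0 \<Longrightarrow> real (card {d. d dvd n}) \<le> C * real n powr \<epsilon>"
proof -
  \<comment> \<open>With this \<open>K\<close> one has \<open>K powr \<epsilon> = 2\<close>. The
    number of primes below \<open>K\<close> is at most \<open>c\<close>, which depends on
    \<open>\<epsilon>\<close> alone.\<close>
  define K where "K = (2::real) powr (1 / \<epsilon>)"
  define c where "c = card {p::nat. real p < K}"
  have fin: "finite {p::nat. real p < K}"
    by (rule finite_subset[of _ "{..nat \<lceil>K\<rceil>}"]) (auto simp: le_nat_iff, linarith)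
  have K: "K powr \<epsilon> \<ge> 2" "K > 0" using assms by (auto simp: K_def powr_powr)
  show ?thesis
  proof (rule that[of "(1 + 2 / \<epsilon>) ^ c"])
    show "(1 + 2 / \<epsilon>) ^ c \<ge> 1" using assms by (intro one_le_power) auto
    fix n :: nat assume n: "n > 0"
    have "card {p \<in> prime_factors n. real p < K} \<le> c"
      unfolding c_def by (intro card_mono fin) auto
    then have "(1 + 2 / \<epsilon>) ^ card {p \<in> prime_factors n. real p < K} \<le> (1 + 2 / \<epsilon>) ^ c"
      using assms by (intro power_increasing) auto
    with card_divisors_le_prime_factors[OF assms K n]
    show "real (card {d. d dvd n}) \<le> (1 + 2 / \<epsilon>) ^ c * real n powr \<epsilon>"
      by (meson mult_right_mono order_trans powr_ge_zero)
  qed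
qed

section \<open>Counting square roots modulo \<open>r\<close> in an interval\<close>

lemma card_congruent_ints_le:
  fixes S :: "int set" and t :: int and B :: real
  assumes "finite S" "t > 0" "B \<ge> 0"
    and "\<And>x y. x \<in> S \<Longrightarrow> y \<in> S \<Longrightarrow> [x = y] (mod t)"
    and "\<And>x y. x \<in> S \<Longrightarrow> y \<in> S \<Longrightarrow> real_of_int (x - y) \<le> B"
  shows "real (card S) \<le> B / t + 1"
proof (cases "S = {}")
  case False
  define s where "s = Min S"
  have s: "s \<in> S" "\<And>x. x \<in> S \<Longrightarrow> s \<le> x" using False assms(1) by (auto simp: s_def)
  let ?f = "\<lambda>x. (x - s) div t"
  have d: "t dvd x - s" if "x \<in> S" for x
    using assms(4)[OF that s(1)] by (simp add: cong_iff_dvd_diff)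
  have "inj_on ?f S"
    using d by (intro inj_onI) (metis diff_add_cancel dvd_div_mult_self)
  moreover have "?f ` S \<subseteq> {0..\<lfloor>B / t\<rfloor>}"
  proof
    fix y assume "y \<in> ?f ` S"
    then obtain x where x: "x \<in> S" "y = ?f x" by auto
    then have "x - s = t * y" using d by auto
    then have "real_of_int t * real_of_int y \<le> B"
      using assms(5)[OF x(1) s(1)] by (metis of_int_mult)
    then have "real_of_int y \<le> B / t" using assms(2) by (simp add: field_simps)
    then show "y \<in> {0..\<lfloor>B / t\<rfloor>}"
      using x s(2)[OF x(1)] assms(2) by (auto simp: le_floor_iff pos_imp_zdiv_nonneg_iff)
  qed
  ultimately have "card S \<le> card {0..\<lfloor>B / t\<rfloor>}"
    by (meson card_inj_on_le finite_atLeastAtMost_int)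
  also have "\<dots> = nat (\<lfloor>B / t\<rfloor> + 1)" by simp
  finally have "real (card S) \<le> real (nat (\<lfloor>B / t\<rfloor> + 1))" by simp
  also have "\<dots> \<le> B / t + 1" using assms by (simp add: of_nat_nat)
  finally show ?thesis .
qed (use assms in simp)

text \<open>\<open>c^2\<close> divides both \<open>4 q^2\<close> and \<open>4 r\<close>, hence
  \<open>4 gcd (q^2) r\<close>. This controls the loss when two complementary divisors of
  \<open>r\<close> share the factor \<open>c\<close>.\<close>

lemma dvd_nat_le_sqrt_gcd:
  fixes c r :: nat and q :: int
  assumes "r > 0" "c\<^sup>2 dvd r" "int c dvd 2 * q"
  shows "real c \<le> 2 * sqrt (gcd (q\<^sup>2) (int r))"
proof -
  have g: "gcd (q\<^sup>2) (int r) > 0" using assms(1) by (simp add: gcd_pos_int)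
  have "(int c)\<^sup>2 dvd (2 * q)\<^sup>2" using assms(3) by (rule dvd_power_same)
  then have "(int c)\<^sup>2 dvd 4 * q\<^sup>2" by (simp add: power_mult_distrib)
  moreover have "(int c)\<^sup>2 dvd 4 * int r"
    using assms(2) by (metis dvd_mult int_dvd_int_iff of_nat_power)
  ultimately have "(int c)\<^sup>2 dvd gcd (4 * q\<^sup>2) (4 * int r)" by (rule gcd_greatest)
  also have "\<dots> = 4 * gcd (q\<^sup>2) (int r)" by (simp add: gcd_mult_distrib_int[symmetric])
  finally have "(int c)\<^sup>2 \<le> 4 * gcd (q\<^sup>2) (int r)" using g by (intro zdvd_imp_le) auto
  then have "real_of_int ((int c)\<^sup>2) \<le> real_of_int (4 * gcd (q\<^sup>2) (int r))" by (simp only: of_int_le_iff)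
  then have "(real c)\<^sup>2 \<le> 4 * real_of_int (gcd (q\<^sup>2) (int r))" by simp
  then have "real c \<le> sqrt (4 * real_of_int (gcd (q\<^sup>2) (int r)))" by (rule real_le_rsqrt)
  then show ?thesis by (simp add: real_sqrt_mult)
qed

text \<open>Fix \<open>q\<^sub>0 \<in> S\<close> and sort \<open>q \<in> S\<close> by \<open>d = gcd (q - q\<^sub>0) r\<close>: then \<open>q \<equiv> q\<^sub>0\<close> modulo \<open>d\<close> and
  \<open>q \<equiv> -q\<^sub>0\<close> modulo \<open>r / d\<close>, and \<open>c = gcd d (r / d)\<close> satisfies \<open>c\<^sup>2 | r\<close> and \<open>c | 2 q\<^sub>0\<close>.\<close>

lemma card_square_roots_le:
  fixes S :: "int set" and r :: nat and B g :: real
  assumes fin: "finite S" and r: "r > 0" and B: "B \<ge> 0" and g0: "g \<ge> 0"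
    and sq: "\<And>x y. x \<in> S \<Longrightarrow> y \<in> S \<Longrightarrow> [x\<^sup>2 = y\<^sup>2] (mod int r)"
    and diff: "\<And>x y. x \<in> S \<Longrightarrow> y \<in> S \<Longrightarrow> real_of_int (x - y) \<le> B * r"
    and g: "\<And>x. x \<in> S \<Longrightarrow> gcd (x\<^sup>2) (int r) = g"
  shows "real (card S) \<le> (B + 1) * 2 * sqrt g * card {d. d dvd r}"
proof (cases "S = {}")
  case False
  then obtain q0 where q0: "q0 \<in> S" by auto
  define T where "T d = {q \<in> S. gcd (q - q0) (int r) = int d}" for d
  have finT: "finite (T d)" for d using fin by (simp add: T_def)
  have "S \<subseteq> (\<Union>d\<in>{d. d dvd r}. T d)"
  proof
    fix q assume q: "q \<in> S"
    have "nat (gcd (q - q0) (int r)) dvd r"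
      by (metis gcd_dvd2 gcd_ge_0_int int_dvd_int_iff int_nat_eq)
    then show "q \<in> (\<Union>d\<in>{d. d dvd r}. T d)" using q by (auto simp: T_def)
  qed
  then have "card S \<le> card (\<Union>d\<in>{d. d dvd r}. T d)"
    using r finT by (intro card_mono) auto
  also have "\<dots> \<le> (\<Sum>d\<in>{d. d dvd r}. card (T d))"
    using r by (intro card_UN_le) auto
  finally have "real (card S) \<le> (\<Sum>d\<in>{d. d dvd r}. real (card (T d)))"
    by (metis of_nat_le_iff of_nat_sum)
  also have "\<dots> \<le> (\<Sum>d\<in>{d. d dvd r}. (B + 1) * 2 * sqrt g)"
  proof (rule sum_mono)
    fix d assume "d \<in> {d. d dvd r}"
    then have d: "d dvd r" by simp
    then have d0: "d > 0" "r div d > 0" using r by (auto elim!: dvdE intro: Nat.gr0I)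
    show "real (card (T d)) \<le> (B + 1) * 2 * sqrt g"
    proof (cases "T d = {}")
      case False
      define c where "c = gcd d (r div d)"
      have c0: "c > 0" using d0 by (simp add: c_def)
      have rd: "r = d * (r div d)" using d by simp
      have 1: "[q = q0] (mod int d)" "[q = - q0] (mod int (r div d))" if "q \<in> T d" for q
      proof -
        have dq: "gcd (q - q0) (int r) = int d" and qS: "q \<in> S" using that by (auto simp: T_def)
        then have dvd: "int d dvd q - q0" by (metis gcd_dvd1)
        then show "[q = q0] (mod int d)" by (simp add: cong_iff_dvd_diff)
        have "int r dvd q\<^sup>2 - q0\<^sup>2" using sq[OF qS q0] by (simp add: cong_iff_dvd_diff)
        then have "int r dvd (q - q0) * (q + q0)" by (simp add: power2_eq_square algebra_simps)
        obtain u where u: "q - q0 = int d * u" using dvd by auto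
        have ir: "int r = int d * int (r div d)" using rd by (metis of_nat_mult)
        have "int d * int (r div d) dvd int d * (u * (q + q0))"
          using \<open>int r dvd (q - q0) * (q + q0)\<close> unfolding u ir[symmetric] by (simp add: mult.assoc)
        then have "int (r div d) dvd u * (q + q0)" using d0 by simp
        \<comment> \<open>Since \<open>d\<close> is the exact gcd of \<open>q - q0\<close> and
          \<open>r\<close>, nothing of \<open>r div d\<close> is left in \<open>u\<close>, so
          \<open>r div d\<close> must divide \<open>q + q0\<close>.\<close>
        moreover have "coprime (int (r div d)) u"
        proof -
          have "gcd (int d * u) (int d * int (r div d)) = int d" using dq u ir by simp
          then have "int d * gcd u (int (r div d)) = int d" by (simp add: gcd_mult_distrib_int[symmetric])
          then have "gcd u (int (r div d)) = 1" using d0 by simp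
          then show ?thesis by (simp add: coprime_iff_gcd_eq_1 gcd.commute)
        qed
        ultimately have "int (r div d) dvd q + q0" by (simp add: coprime_dvd_mult_right_iff)
        then show "[q = - q0] (mod int (r div d))" by (simp add: cong_iff_dvd_diff)
      qed
      \<comment> \<open>The two congruences combine to one modulo the lcm, which is
        \<open>r / c\<close>; the count on an interval of length \<open>B * r\<close> thus loses
        only the factor \<open>c\<close>.\<close>
      have lcm: "lcm (int d) (int (r div d)) * int c = int r"
      proof -
        have "lcm d (r div d) * c = r"
          using prod_gcd_lcm_nat[of d "r div d"] d by (simp add: c_def mult.commute)
        then show ?thesis by (metis lcm_int_int_eq of_nat_mult)
      qed
      have l0: "lcm (int d) (int (r div d)) > 0" using d0 by (intro lcm_pos_int) auto
      have "real (card (T d)) \<le> (B * r) / real_of_int (lcm (int d) (int (r div d))) + 1"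
      proof (rule card_congruent_ints_le)
        fix x y assume xy: "x \<in> T d" "y \<in> T d"
        have "[x = y] (mod int d)" "[x = y] (mod int (r div d))"
          using 1[OF xy(1)] 1[OF xy(2)] by (meson cong_sym cong_trans)+
        then show "[x = y] (mod lcm (int d) (int (r div d)))"
          unfolding cong_iff_dvd_diff by (rule lcm_least)
        show "real_of_int (x - y) \<le> B * real r" using diff xy by (simp add: T_def)
      qed (use finT l0 B in auto)
      also have "(B * r) / real_of_int (lcm (int d) (int (r div d))) = B * c"
      proof -
        have "real r = real_of_int (lcm (int d) (int (r div d))) * real c"
          using arg_cong[OF lcm, of real_of_int] by simp
        moreover define l where "l = lcm (int d) (int (r div d))"
        ultimately show ?thesis using l0 unfolding l_def[symmetric] by simp
      qed
      also have "B * c + 1 \<le> (B + 1) * c" using c0 by (simp add: algebra_simps)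
      also have "\<dots> \<le> (B + 1) * (2 * sqrt g)"
      proof (rule mult_left_mono)
        have "c\<^sup>2 dvd r"
        proof -
          have "c * c dvd d * (r div d)" unfolding c_def by (intro mult_dvd_mono) auto
          then show ?thesis using d by (simp add: power2_eq_square)
        qed
        moreover obtain q where "q \<in> T d" using False by auto
        then have "[q = q0] (mod int c)" "[q = - q0] (mod int c)"
          using 1[of q] by (auto intro: cong_dvd_modulus simp: c_def)
        \<comment> \<open>As \<open>c\<close> divides both moduli, both congruences hold modulo
          \<open>c\<close>; their difference eliminates \<open>q\<close>.\<close>
        then have "int c dvd (q + q0) - (q - q0)"
          unfolding cong_iff_dvd_diff by (metis diff_minus_eq_add dvd_diff)
        then have "int c dvd 2 * q0" by simp
        ultimately have "real c \<le> 2 * sqrt (gcd (q0\<^sup>2) (int r))"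
          using dvd_nat_le_sqrt_gcd r by blast
        then show "real c \<le> 2 * sqrt g" using g[OF q0] by simp
      qed (use B in auto)
      finally show ?thesis by (simp only: mult.assoc)
    qed (use B g0 in auto)
  qed
  finally show ?thesis by (simp add: mult.commute)
qed (use B g0 in auto)

section \<open>The large sieve with a counting function\<close>

lemma e_add: "e (x + y) = e x * e y"
  by (simp add: e_def distrib_left exp_add)

lemma cnj_e: "cnj (e x) = e (- x)"
  by (simp add: e_def exp_cnj)

lemma e_of_nat_mult: "e (real n * t) = e t ^ n"
  by (simp add: e_def exp_of_nat_mult[symmetric] algebra_simps)

lemma norm_e [simp]: "cmod (e x) = 1"
  by (simp add: e_def)

lemma e_of_int [simp]: "e (of_int l) = 1"
  using exp_two_pi_i exp_integer_2pi[of "of_int l"] by (simp add: e_def mult.commute mult.left_commute)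

text \<open>Jordan's inequality: by concavity the sine lies above its chord from \<open>0\<close> to
  \<open>pi / 2\<close>.\<close>

lemma two_mult_le_sin_pi:
  assumes "0 \<le> s" "s \<le> 1 / 2"
  shows "2 * s \<le> sin (pi * s)"
proof -
  have "concave_on {0..pi/2} sin"
    by (rule f''_le0_imp_concave[where f' = cos and f'' = "\<lambda>x. - sin x"])
      (auto intro!: derivative_eq_intros sin_ge_zero)
  from concave_onD[OF this, of "2 * s" 0 "pi / 2"] assms show ?thesis
    by (simp add: mult.commute)
qed

lemma norm_one_minus_e_ge:
  assumes "\<bar>s\<bar> \<le> 1 / 2"
  shows "cmod (1 - e s) \<ge> 4 * \<bar>s\<bar>"
proof -
  have "1 - e s = e (s / 2) * (e (- s / 2) - e (s / 2))"
    by (simp add: right_diff_distrib e_add[symmetric]) (simp add: e_def)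
  then have "cmod (1 - e s) = cmod (e (- s / 2) - e (s / 2))" by (simp add: norm_mult)
  also have "e (- s / 2) - e (s / 2) = - 2 * \<i> * of_real (sin (pi * s))"
    by (simp add: e_def exp_Euler complex_eq_iff Re_exp Im_exp)
  also have "cmod \<dots> = 2 * \<bar>sin (pi * s)\<bar>" by (simp add: norm_mult)
  finally have "cmod (1 - e s) = 2 * \<bar>sin (pi * s)\<bar>" .
  moreover have "\<bar>sin (pi * s)\<bar> \<ge> 2 * \<bar>s\<bar>"
    using two_mult_le_sin_pi[of "\<bar>s\<bar>"] assms by (cases "s \<ge> 0") (auto simp: abs_if)
  ultimately show ?thesis by simp
qed

definition dirichlet_kernel :: "nat \<Rightarrow> real \<Rightarrow> complex" where
  "dirichlet_kernel n t = (\<Sum>u<n. e (real u * t))"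

lemma dirichlet_kernel_uminus: "dirichlet_kernel n (- t) = cnj (dirichlet_kernel n t)"
  by (simp add: dirichlet_kernel_def cnj_e)

lemma norm_dirichlet_kernel_le: "cmod (dirichlet_kernel n t) \<le> real n"
  unfolding dirichlet_kernel_def by (rule order_trans[OF norm_sum]) simp

text \<open>Geometric series with ratio \<open>e s\<close>: the numerator is at most 2 and the
  denominator at least \<open>4 * \<bar>s\<bar>\<close>. Here \<open>s\<close> is the representative
  of \<open>t\<close> modulo 1 of least absolute value.\<close>

lemma norm_dirichlet_kernel_le_inverse:
  fixes s t :: real
  assumes "t = of_int l + s" "\<bar>s\<bar> \<le> 1 / 2" "s \<noteq> 0"
  shows "cmod (dirichlet_kernel n t) \<le> 1 / (2 * \<bar>s\<bar>)"
proof -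
  have es: "e t = e s" by (simp add: assms(1) e_add)
  have ge: "cmod (1 - e s) \<ge> 4 * \<bar>s\<bar>" using norm_one_minus_e_ge assms(2) by blast
  then have "cmod (1 - e s) > 0" using assms(3) by (smt (verit) zero_less_abs_iff)
  then have ne: "1 - e s \<noteq> 0" by simp
  have "dirichlet_kernel n t = (\<Sum>u<n. e s ^ u)"
    by (simp add: dirichlet_kernel_def e_of_nat_mult es)
  also have "\<dots> = (1 - e s ^ n) / (1 - e s)" using ne by (simp add: sum_gp_strict)
  finally have "cmod (dirichlet_kernel n t) = cmod (1 - e s ^ n) / cmod (1 - e s)"
    by (simp add: norm_divide)
  also have "\<dots> \<le> 2 / (4 * \<bar>s\<bar>)"
  proof (rule frac_le)
    show "cmod (1 - e s ^ n) \<le> 2"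
      using norm_triangle_ineq4[of 1 "e s ^ n"] by (simp add: norm_power)
  qed (use ge assms in auto)
  finally show ?thesis by simp
qed

lemma sum_telescope_inverse:
  "(\<Sum>k<n. 1 / ((real k + 1) * (real k + 2))) = 1 - 1 / (real n + 1)"
proof (induction n)
  case (Suc n)
  have "1 - 1 / (real n + 1) + 1 / ((real n + 1) * (real n + 2)) = 1 - 1 / (real n + 2)"
    by (simp add: divide_simps) (simp add: algebra_simps)
  then show ?case using Suc by (simp add: add.commute)
qed simp

text \<open>The denominator \<open>(k + 1) (k + 2)\<close>, in place of \<open>k\<^sup>2\<close>, makes the sum over \<open>k\<close> telescope.\<close>

lemma large_sieve_kernel_le:
  fixes L :: nat and s t :: real
  assumes "t = of_int l + s" "\<bar>s\<bar> \<le> 1 / 2" "L > 0"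
  shows "cmod (dirichlet_kernel (2 * L) t * cnj (dirichlet_kernel L t))
    \<le> 4 * real L ^ 2 / ((real (nat \<lfloor>L * \<bar>s\<bar>\<rfloor>) + 1) * (real (nat \<lfloor>L * \<bar>s\<bar>\<rfloor>) + 2))"
proof -
  define k where "k = nat \<lfloor>L * \<bar>s\<bar>\<rfloor>"
  show ?thesis unfolding k_def[symmetric]
  proof (cases "k = 0")
    case True
    \<comment> \<open>For \<open>k = 0\<close> the claimed bound is \<open>4 L^2 / 2\<close>,
      exactly the trivial one.\<close>
    have "cmod (dirichlet_kernel (2 * L) t) * cmod (dirichlet_kernel L t) \<le> real (2 * L) * real L"
      by (intro mult_mono norm_dirichlet_kernel_le) auto
    then show "cmod (dirichlet_kernel (2 * L) t * cnj (dirichlet_kernel L t))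
      \<le> 4 * real L ^ 2 / ((real k + 1) * (real k + 2))"
      using True by (simp add: norm_mult power2_eq_square)
  next
    case False
    then have k1: "real k \<ge> 1" by simp
    have kL: "real k \<le> L * \<bar>s\<bar>" unfolding k_def by simp
    with k1 have "real L * \<bar>s\<bar> > 0" by linarith
    then have s0: "\<bar>s\<bar> > 0" using assms(3) by (simp add: zero_less_mult_iff)
    have "cmod (dirichlet_kernel (2 * L) t) * cmod (dirichlet_kernel L t) \<le> (1 / (2 * \<bar>s\<bar>)) * (1 / (2 * \<bar>s\<bar>))"
      using s0 by (intro mult_mono norm_dirichlet_kernel_le_inverse[OF assms(1,2)]) auto
    also have "1 / (2 * \<bar>s\<bar>) \<le> L / (2 * k)"
      using kL s0 k1 by (simp add: field_simps)
    then have "(1 / (2 * \<bar>s\<bar>)) * (1 / (2 * \<bar>s\<bar>)) \<le> (L / (2 * k)) * (L / (2 * k))"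
      using s0 by (intro mult_mono) auto
    also have "\<dots> = real L ^ 2 * (1 / (4 * real k ^ 2))" by (simp add: power2_eq_square)
    also have "\<dots> \<le> real L ^ 2 * (4 / ((real k + 1) * (real k + 2)))"
    proof (rule mult_left_mono)
      have "(real k + 1) * (real k + 2) \<le> (2 * real k) * (3 * real k)"
        using k1 by (intro mult_mono) auto
      also have "\<dots> \<le> 16 * real k ^ 2" by (simp add: power2_eq_square)
      finally show "1 / (4 * real k ^ 2) \<le> 4 / ((real k + 1) * (real k + 2))"
        using k1 by (simp add: divide_simps)
    qed simp
    finally show "cmod (dirichlet_kernel (2 * L) t * cnj (dirichlet_kernel L t))
      \<le> 4 * real L ^ 2 / ((real k + 1) * (real k + 2))"
      by (simp add: norm_mult mult.commute)
  qed
qed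

text \<open>The points are sorted into shells by their distance from \<open>\<beta>\<close> modulo
  1, in steps of \<open>1 / L\<close>. Shell \<open>n\<close> lies within \<open>1 / L\<close> of
  \<open>\<beta> + n / L\<close> or \<open>\<beta> - n / L\<close>, so it holds at most
  \<open>2 * K\<close> points, and the kernel bounds telescope over the shells.\<close>

lemma sum_large_sieve_kernel_le:
  fixes X :: "'i set" and x :: "'i \<Rightarrow> real" and L :: nat and K :: real
  assumes fin: "finite X" and L: "L > 0" and K: "K \<ge> 0"
    and count: "\<And>\<beta>. real (card {i \<in> X. \<exists>l::int. \<bar>x i - \<beta> - of_int l\<bar> \<le> 1 / real L}) \<le> K"
  shows "(\<Sum>i\<in>X. cmod (dirichlet_kernel (2 * L) (x i - \<beta>) * cnj (dirichlet_kernel L (x i - \<beta>))))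
           \<le> 8 * K * real L ^ 2"
proof -
  define s where "s i = x i - \<beta> - of_int (round (x i - \<beta>))" for i
  define k where "k i = nat \<lfloor>L * \<bar>s i\<bar>\<rfloor>" for i
  define h where "h n = 4 * real L ^ 2 * (1 / ((real n + 1) * (real n + 2)))" for n :: nat
  have s: "x i - \<beta> = of_int (round (x i - \<beta>)) + s i" "\<bar>s i\<bar> \<le> 1 / 2" for i
    using of_int_round_abs_le[of "x i - \<beta>"] unfolding s_def by linarith+
  have kL: "k i < L" for i
  proof -
    have "real L * \<bar>s i\<bar> \<le> real L * (1 / 2)" using s(2) by (intro mult_left_mono) auto
    also have "\<dots> < real L" using L by simp
    finally show ?thesis unfolding k_def by (simp add: nat_less_iff floor_less_iff)
  qed
  have ck: "real (card {i \<in> X. k i = n}) \<le> 2 * K" for n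
  proof -
    have "{i \<in> X. k i = n} \<subseteq> {i \<in> X. \<exists>l::int. \<bar>x i - (\<beta> + n / L) - of_int l\<bar> \<le> 1 / real L}
        \<union> {i \<in> X. \<exists>l::int. \<bar>x i - (\<beta> - n / L) - of_int l\<bar> \<le> 1 / real L}" (is "_ \<subseteq> ?A \<union> ?B")
    proof
      fix i assume "i \<in> {i \<in> X. k i = n}"
      then have i: "i \<in> X" "k i = n" by auto
      have "\<lfloor>L * \<bar>s i\<bar>\<rfloor> = int n" using i(2) unfolding k_def by auto
      then have "real n \<le> L * \<bar>s i\<bar>" "L * \<bar>s i\<bar> \<le> real n + 1" by linarith+
      then have b: "real n / L \<le> \<bar>s i\<bar>" "\<bar>s i\<bar> \<le> real n / L + 1 / L"
        using L by (simp_all add: field_simps)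
      show "i \<in> ?A \<union> ?B"
      proof (cases "s i \<ge> 0")
        case True
        have "\<bar>x i - (\<beta> + n / L) - of_int (round (x i - \<beta>))\<bar> \<le> 1 / real L"
          using s(1)[of i] b True by (simp add: abs_le_iff)
        then show ?thesis using i by blast
      next
        case False
        have "\<bar>x i - (\<beta> - n / L) - of_int (round (x i - \<beta>))\<bar> \<le> 1 / real L"
          using s(1)[of i] b False by (simp add: abs_le_iff)
        then show ?thesis using i by blast
      qed
    qed
    then have "card {i \<in> X. k i = n} \<le> card (?A \<union> ?B)" using fin by (intro card_mono) auto
    also have "\<dots> \<le> card ?A + card ?B" by (rule card_Un_le)
    finally show ?thesis using count[of "\<beta> + n / L"] count[of "\<beta> - n / L"] by linarith
  qed
  have "(\<Sum>i\<in>X. cmod (dirichlet_kernel (2 * L) (x i - \<beta>) * cnj (dirichlet_kernel L (x i - \<beta>))))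
      \<le> (\<Sum>i\<in>X. h (k i))"
    using large_sieve_kernel_le[OF s L] by (intro sum_mono) (simp add: h_def k_def)
  also have "\<dots> = (\<Sum>n<L. \<Sum>i\<in>{i \<in> X. k i = n}. h (k i))"
    by (rule sum.group[symmetric]) (use fin kL in auto)
  also have "\<dots> = (\<Sum>n<L. real (card {i \<in> X. k i = n}) * h n)" by simp
  also have "\<dots> \<le> (\<Sum>n<L. 2 * K * h n)"
    by (intro sum_mono mult_right_mono ck) (simp add: h_def)
  also have "\<dots> = 8 * K * real L ^ 2 * (\<Sum>n<L. 1 / ((real n + 1) * (real n + 2)))"
    by (simp add: h_def sum_distrib_left mult_ac)
  also have "\<dots> \<le> 8 * K * real L ^ 2 * 1"
    using K by (intro mult_left_mono) (simp_all add: sum_telescope_inverse)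
  finally show ?thesis by simp
qed

lemma sum_swap4:
  "(\<Sum>v\<in>A. \<Sum>u\<in>B. \<Sum>i\<in>X. \<Sum>j\<in>Y. F v u i j) = (\<Sum>i\<in>X. \<Sum>j\<in>Y. \<Sum>v\<in>A. \<Sum>u\<in>B. F v u i j)"
proof -
  have "(\<Sum>v\<in>A. \<Sum>u\<in>B. \<Sum>i\<in>X. \<Sum>j\<in>Y. F v u i j) = (\<Sum>v\<in>A. \<Sum>i\<in>X. \<Sum>u\<in>B. \<Sum>j\<in>Y. F v u i j)"
    by (intro sum.cong refl sum.swap)
  also have "\<dots> = (\<Sum>i\<in>X. \<Sum>v\<in>A. \<Sum>u\<in>B. \<Sum>j\<in>Y. F v u i j)" by (rule sum.swap)
  also have "\<dots> = (\<Sum>i\<in>X. \<Sum>v\<in>A. \<Sum>j\<in>Y. \<Sum>u\<in>B. F v u i j)" by (intro sum.cong refl sum.swap)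
  also have "\<dots> = (\<Sum>i\<in>X. \<Sum>j\<in>Y. \<Sum>v\<in>A. \<Sum>u\<in>B. F v u i j)" by (intro sum.cong refl sum.swap)
  finally show ?thesis .
qed

text \<open>Averaging over \<open>L\<close> shifted windows of length \<open>2 * L\<close>, each
  covering \<open>I\<close>, replaces the sharp cutoff by the kernel \<open>W\<close>, which decays
  quadratically. Its row sums are bounded by the counting hypothesis, and a Schur test
  finishes.\<close>

lemma dual_large_sieve:
  fixes X :: "'i set" and x :: "'i \<Rightarrow> real" and L :: nat and K :: real and c :: "'i \<Rightarrow> complex"
    and I :: "int set" and n0 :: int
  assumes fin: "finite X" and L: "L > 0" and K: "K \<ge> 0"
    and count: "\<And>\<beta>. real (card {i \<in> X. \<exists>l::int. \<bar>x i - \<beta> - of_int l\<bar> \<le> 1 / real L}) \<le> K"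
    and I: "I \<subseteq> {n0..<n0 + int L}"
  shows "(\<Sum>n\<in>I. (cmod (\<Sum>i\<in>X. c i * e (of_int n * x i)))\<^sup>2) \<le> 8 * K * L * (\<Sum>i\<in>X. (cmod (c i))\<^sup>2)"
proof -
  define T where "T n = (\<Sum>i\<in>X. c i * e (of_int n * x i))" for n :: int
  define W where "W t = dirichlet_kernel (2 * L) t * cnj (dirichlet_kernel L t)" for t
  have Wsym: "cmod (W (- t)) = cmod (W t)" for t
    by (simp add: W_def dirichlet_kernel_uminus norm_mult)
  have finI: "finite I" using I finite_subset by blast
  \<comment> \<open>The window starting at \<open>n0 - v\<close> still reaches past
    \<open>n0 + L\<close> because \<open>v < L\<close>; this is why its length is twice that of
    \<open>I\<close>.\<close>
  have shift: "(\<Sum>n\<in>I. (cmod (T n))\<^sup>2) \<le> (\<Sum>u<2 * L. (cmod (T (n0 + int u - int v)))\<^sup>2)" if "v < L" for v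
  proof -
    have "(\<Sum>n\<in>I. (cmod (T n))\<^sup>2) \<le> (\<Sum>n\<in>(\<lambda>u. n0 + int u - int v) ` {..<2 * L}. (cmod (T n))\<^sup>2)"
    proof (rule sum_mono2)
      show "I \<subseteq> (\<lambda>u. n0 + int u - int v) ` {..<2 * L}"
      proof
        fix n assume "n \<in> I"
        then have "n0 \<le> n" "n < n0 + int L" using I by auto
        then have "n = n0 + int (nat (n - n0 + int v)) - int v" "nat (n - n0 + int v) < 2 * L"
          using that by auto
        then show "n \<in> (\<lambda>u. n0 + int u - int v) ` {..<2 * L}" by blast
      qed
    qed auto
    also have "\<dots> = (\<Sum>u<2 * L. (cmod (T (n0 + int u - int v)))\<^sup>2)"
      by (subst sum.reindex) (auto simp: inj_on_def)
    finally show ?thesis .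
  qed
  have expand: "complex_of_real ((cmod (T (n0 + int u - int v)))\<^sup>2) =
      (\<Sum>i\<in>X. \<Sum>j\<in>X. c i * cnj (c j) * e (of_int n0 * (x i - x j)) *
         (e (real u * (x i - x j)) * cnj (e (real v * (x i - x j)))))" for u v :: nat
  proof -
    have *: "e (of_int (n0 + int u - int v) * y) * cnj (e (of_int (n0 + int u - int v) * z)) =
       e (of_int n0 * (y - z)) * (e (real u * (y - z)) * cnj (e (real v * (y - z))))" for y z
      by (simp add: cnj_e e_add[symmetric] algebra_simps)
    show ?thesis unfolding complex_norm_square T_def cnj_sum sum_product
      by (intro sum.cong refl) (simp add: *[symmetric])
  qed
  have "complex_of_real (\<Sum>v<L. \<Sum>u<2 * L. (cmod (T (n0 + int u - int v)))\<^sup>2) =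
      (\<Sum>v<L. \<Sum>u<2 * L. \<Sum>i\<in>X. \<Sum>j\<in>X. c i * cnj (c j) * e (of_int n0 * (x i - x j)) *
         (e (real u * (x i - x j)) * cnj (e (real v * (x i - x j)))))"
    by (simp only: of_real_sum expand)
  also have "\<dots> = (\<Sum>i\<in>X. \<Sum>j\<in>X. \<Sum>v<L. \<Sum>u<2 * L. c i * cnj (c j) * e (of_int n0 * (x i - x j)) *
         (e (real u * (x i - x j)) * cnj (e (real v * (x i - x j)))))"
    by (rule sum_swap4)
  also have "\<dots> = (\<Sum>i\<in>X. \<Sum>j\<in>X. c i * cnj (c j) * e (of_int n0 * (x i - x j)) * W (x i - x j))"
    unfolding W_def dirichlet_kernel_def cnj_sum sum_product
    by (intro sum.cong refl) (subst sum.swap, simp add: sum_distrib_left)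
  finally have eq: "complex_of_real (\<Sum>v<L. \<Sum>u<2 * L. (cmod (T (n0 + int u - int v)))\<^sup>2) = \<dots>" .
  have "real L * (\<Sum>n\<in>I. (cmod (T n))\<^sup>2) = (\<Sum>v<L. \<Sum>n\<in>I. (cmod (T n))\<^sup>2)" by simp
  also have "\<dots> \<le> (\<Sum>v<L. \<Sum>u<2 * L. (cmod (T (n0 + int u - int v)))\<^sup>2)"
    using shift by (intro sum_mono) auto
  also have "\<dots> = cmod (complex_of_real (\<Sum>v<L. \<Sum>u<2 * L. (cmod (T (n0 + int u - int v)))\<^sup>2))"
    by (subst norm_of_real) (simp add: sum_nonneg)
  also have "\<dots> \<le> (\<Sum>i\<in>X. \<Sum>j\<in>X. cmod (c i) * cmod (c j) * cmod (W (x i - x j)))"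
    unfolding eq by (intro order_trans[OF norm_sum] sum_mono) (simp add: norm_mult)
  \<comment> \<open>Schur test: after the arithmetic-geometric mean inequality the two halves agree,
    since \<open>cmod (W t)\<close> is even, and each row sum can be bounded separately.\<close>
  also have "\<dots> \<le> (\<Sum>i\<in>X. \<Sum>j\<in>X. ((cmod (c i))\<^sup>2 / 2 + (cmod (c j))\<^sup>2 / 2) * cmod (W (x i - x j)))"
  proof (intro sum_mono mult_right_mono)
    fix i j
    show "cmod (c i) * cmod (c j) \<le> (cmod (c i))\<^sup>2 / 2 + (cmod (c j))\<^sup>2 / 2"
      using sum_squares_bound[of "cmod (c i)" "cmod (c j)"] by simp
  qed auto
  also have "\<dots> = (\<Sum>i\<in>X. \<Sum>j\<in>X. (cmod (c i))\<^sup>2 / 2 * cmod (W (x i - x j))) +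
      (\<Sum>i\<in>X. \<Sum>j\<in>X. (cmod (c j))\<^sup>2 / 2 * cmod (W (x i - x j)))"
    by (simp add: distrib_right sum.distrib)
  also have "(\<Sum>i\<in>X. \<Sum>j\<in>X. (cmod (c i))\<^sup>2 / 2 * cmod (W (x i - x j))) =
      (\<Sum>i\<in>X. \<Sum>j\<in>X. (cmod (c i))\<^sup>2 / 2 * cmod (W (x j - x i)))"
    using Wsym[of "x _ - x _"] by (intro sum.cong refl) (metis minus_diff_eq Wsym)
  also have "(\<Sum>i\<in>X. \<Sum>j\<in>X. (cmod (c j))\<^sup>2 / 2 * cmod (W (x i - x j))) =
      (\<Sum>i\<in>X. \<Sum>j\<in>X. (cmod (c i))\<^sup>2 / 2 * cmod (W (x j - x i)))"
    by (rule sum.swap)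
  also have "(\<Sum>i\<in>X. \<Sum>j\<in>X. (cmod (c i))\<^sup>2 / 2 * cmod (W (x j - x i))) +
      (\<Sum>i\<in>X. \<Sum>j\<in>X. (cmod (c i))\<^sup>2 / 2 * cmod (W (x j - x i))) =
      (\<Sum>i\<in>X. (cmod (c i))\<^sup>2 * (\<Sum>j\<in>X. cmod (W (x j - x i))))"
    by (simp add: sum.distrib[symmetric] sum_distrib_left)
  also have "\<dots> \<le> (\<Sum>i\<in>X. (cmod (c i))\<^sup>2 * (8 * K * real L ^ 2))"
    unfolding W_def by (intro sum_mono mult_left_mono sum_large_sieve_kernel_le[OF fin L K count]) auto
  also have "\<dots> = real L * (8 * K * L * (\<Sum>i\<in>X. (cmod (c i))\<^sup>2))"
    by (simp add: sum_distrib_left sum_distrib_right power2_eq_square mult_ac)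
  finally show ?thesis using L unfolding T_def by simp
qed

text \<open>Duality: opening one factor \<open>S i\<close> in \<open>\<Sigma>\<close> and applying
  Cauchy-Schwarz over \<open>n\<close> leaves the dual sum with coefficients
  \<open>cnj (S i)\<close>. The dual bound returns a factor \<open>\<Sigma>\<close>, which
  cancels.\<close>

lemma large_sieve:
  fixes X :: "'i set" and x :: "'i \<Rightarrow> real" and L :: nat and K :: real and a :: "int \<Rightarrow> complex"
    and I :: "int set" and n0 :: int
  assumes fin: "finite X" and L: "L > 0" and K: "K \<ge> 0"
    and count: "\<And>\<beta>. real (card {i \<in> X. \<exists>l::int. \<bar>x i - \<beta> - of_int l\<bar> \<le> 1 / real L}) \<le> K"
    and I: "I \<subseteq> {n0..<n0 + int L}"
  shows "(\<Sum>i\<in>X. (cmod (\<Sum>n\<in>I. a n * e (of_int n * x i)))\<^sup>2) \<le> 8 * K * L * (\<Sum>n\<in>I. (cmod (a n))\<^sup>2)"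
proof -
  define S where "S i = (\<Sum>n\<in>I. a n * e (of_int n * x i))" for i
  define \<Sigma> where "\<Sigma> = (\<Sum>i\<in>X. (cmod (S i))\<^sup>2)"
  define T where "T n = (\<Sum>i\<in>X. cnj (S i) * e (of_int n * x i))" for n :: int
  define Z where "Z = (\<Sum>n\<in>I. (cmod (a n))\<^sup>2)"
  have Sn: "\<Sigma> \<ge> 0" "Z \<ge> 0" unfolding \<Sigma>_def Z_def by (auto intro: sum_nonneg)
  have "complex_of_real \<Sigma> = (\<Sum>i\<in>X. S i * cnj (S i))"
    by (simp only: \<Sigma>_def of_real_sum complex_norm_square)
  also have "\<dots> = (\<Sum>i\<in>X. \<Sum>n\<in>I. a n * (cnj (S i) * e (of_int n * x i)))"
    by (intro sum.cong refl, subst S_def) (simp only: sum_distrib_right, simp add: mult_ac)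
  also have "\<dots> = (\<Sum>n\<in>I. a n * T n)"
    by (subst sum.swap) (simp add: T_def sum_distrib_left)
  finally have "\<Sigma> = cmod (\<Sum>n\<in>I. a n * T n)"
    using Sn by (metis abs_of_nonneg norm_of_real)
  also have "\<dots> \<le> (\<Sum>n\<in>I. cmod (a n) * cmod (T n))"
    by (rule order_trans[OF norm_sum]) (simp add: norm_mult)
  finally have "\<Sigma>\<^sup>2 \<le> (\<Sum>n\<in>I. cmod (a n) * cmod (T n))\<^sup>2" using Sn by (intro power_mono)
  also have "\<dots> \<le> Z * (\<Sum>n\<in>I. (cmod (T n))\<^sup>2)"
    unfolding Z_def by (rule Cauchy_Schwarz_ineq_sum)
  also have "\<dots> \<le> Z * (8 * K * L * (\<Sum>i\<in>X. (cmod (cnj (S i)))\<^sup>2))"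
    unfolding T_def using Sn(2) by (intro mult_left_mono dual_large_sieve[OF fin L K count I])
  also have "(\<Sum>i\<in>X. (cmod (cnj (S i)))\<^sup>2) = \<Sigma>" by (simp add: \<Sigma>_def)
  finally have "\<Sigma> * \<Sigma> \<le> (8 * K * L * Z) * \<Sigma>" by (simp add: power2_eq_square mult_ac)
  then have "\<Sigma> \<le> 8 * K * L * Z"
    using Sn K by (cases "\<Sigma> = 0") auto
  then show ?thesis by (simp add: \<Sigma>_def Z_def S_def)
qed

section \<open>A lower bound for the additive energy\<close>

text \<open>Cauchy-Schwarz over the fibres of \<open>f\<close>: their sizes add up to
  \<open>card T\<close>, and their squares count the collisions.\<close>

lemma power2_card_le_card_collisions:
  fixes f :: "'a \<Rightarrow> 'b"
  assumes "finite T"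
  shows "(card T)\<^sup>2 \<le> card (f ` T) * card {(x, y) \<in> T \<times> T. f x = f y}"
proof -
  let ?c = "\<lambda>v. real (card {x \<in> T. f x = v})"
  have "{(x, y) \<in> T \<times> T. f x = f y} = (\<Union>v\<in>f ` T. {x \<in> T. f x = v} \<times> {x \<in> T. f x = v})"
    by auto
  also have "card \<dots> = (\<Sum>v\<in>f ` T. card ({x \<in> T. f x = v} \<times> {x \<in> T. f x = v}))"
    using assms by (intro card_UN_disjoint) auto
  finally have 1: "real (card {(x, y) \<in> T \<times> T. f x = f y}) = (\<Sum>v\<in>f ` T. (?c v)\<^sup>2)"
    by (simp add: card_cartesian_product power2_eq_square)
  have "card T = (\<Sum>v\<in>f ` T. card {x \<in> T. f x = v})"
    using sum.group[of T "f ` T" f "\<lambda>_. 1::nat"] assms by simp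
  then have "(real (card T))\<^sup>2 = (\<Sum>v\<in>f ` T. ?c v)\<^sup>2" by (simp flip: of_nat_sum)
  also have "\<dots> \<le> (\<Sum>v\<in>f ` T. (?c v)\<^sup>2) * card (f ` T)"
    by (rule sum_squared_le_sum_of_squares)
  finally show ?thesis unfolding 1[symmetric]
    by (metis (mono_tags, lifting) mult.commute of_nat_le_iff of_nat_mult of_nat_power)
qed

lemma finite_int_real_interval: "finite {x::int. 1 \<le> x \<and> real_of_int x \<le> M}"
  by (rule finite_subset[of _ "{1..\<lfloor>M\<rfloor>}"]) (auto simp: le_floor_iff)

lemma finite_E4_tuples: "finite (E4_tuples r j M H)"
proof -
  let ?A = "{1..8::nat} \<rightarrow>\<^sub>E {x::int. 1 \<le> x \<and> real_of_int x \<le> M}"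
  let ?B = "{1..8::nat} \<rightarrow>\<^sub>E {0..<int r}"
  have "E4_tuples r j M H \<subseteq> ?A \<times> ?B"
  proof
    fix z assume "z \<in> E4_tuples r j M H"
    then obtain m k where z: "z = (m, k)" "m \<in> ?A" "k \<in> (\<Pi>\<^sub>E i\<in>{1..8}. modular_sqrts r (int j * m i))"
      unfolding E4_tuples_def by blast
    have "(\<Pi>\<^sub>E i\<in>{1..8::nat}. modular_sqrts r (int j * m i)) \<subseteq> ?B"
      by (rule PiE_mono) (auto simp: modular_sqrts_def)
    with z show "z \<in> ?A \<times> ?B" by blast
  qed
  moreover have "finite (?A \<times> ?B)"
    by (intro finite_cartesian_product finite_PiE finite_int_real_interval) auto
  ultimately show ?thesis by (rule finite_subset)
qed

text \<open>Entries are numbered from 1 and the value is \<open>undefined\<close> elsewhere, to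
  match the extensional functions in \<open>E4_tuples\<close>.\<close>

definition tuple_of_list :: "'a list \<Rightarrow> nat \<Rightarrow> 'a" where
  "tuple_of_list xs i = (if i \<in> {1..8} then xs ! (i - 1) else undefined)"

lemma tuple_of_list_inject:
  assumes "length xs = 8" "length ys = 8" "tuple_of_list xs = tuple_of_list ys"
  shows "xs = ys"
proof (rule nth_equalityI)
  fix i assume "i < length xs"
  then show "xs ! i = ys ! i"
    using fun_cong[OF assms(3), of "Suc i"] assms(1,2) by (simp add: tuple_of_list_def)
qed (use assms in simp)

lemma ball_1_8: "(\<forall>i\<in>{1..8::nat}. P i) \<longleftrightarrow> P 1 \<and> P 2 \<and> P 3 \<and> P 4 \<and> P 5 \<and> P 6 \<and> P 7 \<and> P 8"
proof -
  have "{1..8::nat} = {1, 2, 3, 4, 5, 6, 7, 8}" by auto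
  then show ?thesis by simp
qed

text \<open>A collision consists of four pairs in \<open>T\<close>, that is, of eight points
  \<open>(m, k)\<close>. Two distinct integers in \<open>[1, M]\<close> differ by at least 1 and at
  most \<open>M\<close>, so with \<open>H = M\<close> the spacing condition holds; equality of the
  sums in the integers implies the congruence.\<close>

lemma collisions_le_E4:
  fixes S :: "(int \<times> int) set" and r j :: nat and M :: real
  assumes m: "\<And>p. p \<in> S \<Longrightarrow> 1 \<le> fst p \<and> real_of_int (fst p) \<le> M"
    and k: "\<And>p. p \<in> S \<Longrightarrow> snd p \<in> modular_sqrts r (int j * fst p)"
    and T: "T = {(p, q) \<in> S \<times> S. fst p \<noteq> fst q}"
    and f: "f = (\<lambda>((p, q), (p', q')). snd p - snd q + snd p' - snd q')"
  shows "card {(x, y) \<in> (T \<times> T) \<times> (T \<times> T). f x = f y} \<le> E4 r j M M"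
proof -
  define \<Phi> :: "((((int \<times> int) \<times> (int \<times> int)) \<times> ((int \<times> int) \<times> (int \<times> int))) \<times>
      (((int \<times> int) \<times> (int \<times> int)) \<times> ((int \<times> int) \<times> (int \<times> int)))) \<Rightarrow> (nat \<Rightarrow> int) \<times> (nat \<Rightarrow> int)" where
    "\<Phi> = (\<lambda>(((p1, p2), (p3, p4)), ((p5, p6), (p7, p8))).
      (tuple_of_list [fst p1, fst p2, fst p3, fst p4, fst p5, fst p6, fst p7, fst p8],
       tuple_of_list [snd p1, snd p2, snd p3, snd p4, snd p5, snd p6, snd p7, snd p8]))"
  have "inj_on \<Phi> X" for X
  proof (rule inj_onI)
    fix x y assume "\<Phi> x = \<Phi> y"
    then show "x = y"
      unfolding \<Phi>_def by (auto simp: split_beta dest!: tuple_of_list_inject[rotated 2] intro!: prod_eqI)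
  qed
  moreover have "\<Phi> ` {(x, y) \<in> (T \<times> T) \<times> (T \<times> T). f x = f y} \<subseteq> E4_tuples r j M M"
  proof
    fix z assume "z \<in> \<Phi> ` {(x, y) \<in> (T \<times> T) \<times> (T \<times> T). f x = f y}"
    then obtain w where w: "f (fst w) = f (snd w)" "fst w \<in> T \<times> T" "snd w \<in> T \<times> T" and z0: "z = \<Phi> w"
      by auto
    obtain x y where "w = (x, y)" by (cases w)
    moreover obtain t1 t2 where "x = (t1, t2)" by (cases x)
    moreover obtain t3 t4 where "y = (t3, t4)" by (cases y)
    moreover obtain p1 p2 where "t1 = (p1, p2)" by (cases t1)
    moreover obtain p3 p4 where "t2 = (p3, p4)" by (cases t2)
    moreover obtain p5 p6 where "t3 = (p5, p6)" by (cases t3)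
    moreover obtain p7 p8 where "t4 = (p7, p8)" by (cases t4)
    ultimately have w_eq: "w = (((p1, p2), (p3, p4)), ((p5, p6), (p7, p8)))" by simp
    have S: "p1 \<in> S" "p2 \<in> S" "p3 \<in> S" "p4 \<in> S" "p5 \<in> S" "p6 \<in> S" "p7 \<in> S" "p8 \<in> S"
      and ne: "fst p1 \<noteq> fst p2" "fst p3 \<noteq> fst p4" "fst p5 \<noteq> fst p6" "fst p7 \<noteq> fst p8"
      using w(2,3) by (simp_all add: w_eq T)
    have eq: "snd p1 - snd p2 + snd p3 - snd p4 = snd p5 - snd p6 + snd p7 - snd p8"
      using w(1) by (simp add: w_eq f)
    have z: "z = (tuple_of_list [fst p1, fst p2, fst p3, fst p4, fst p5, fst p6, fst p7, fst p8],
       tuple_of_list [snd p1, snd p2, snd p3, snd p4, snd p5, snd p6, snd p7, snd p8])"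
      by (simp add: z0 w_eq \<Phi>_def)
    note mm = S[THEN m] and kk = S[THEN k]
    have d: "1 \<le> \<bar>a - b\<bar> \<and> real_of_int \<bar>a - b\<bar> \<le> M"
      if "1 \<le> a \<and> real_of_int a \<le> M" "1 \<le> b \<and> real_of_int b \<le> M" "a \<noteq> b" for a b
      using that by (auto simp: abs_if)
    show "z \<in> E4_tuples r j M M"
      unfolding z E4_tuples_def PiE_iff ball_1_8
      using mm kk eq d[OF mm(1) mm(2) ne(1)] d[OF mm(3) mm(4) ne(2)] d[OF mm(5) mm(6) ne(3)]
        d[OF mm(7) mm(8) ne(4)]
      by (simp add: tuple_of_list_def extensional_def)
  qed
  ultimately show ?thesis
    unfolding E4_def using finite_E4_tuples by (meson card_inj_on_le)
qed

text \<open>Eighth power because the pairs with distinct \<open>m\<close> number at least half of \<open>S \<times> S\<close>, and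
  the sums \<open>k\<^sub>1 - k\<^sub>2 + k\<^sub>3 - k\<^sub>4\<close> take at most \<open>4 Q + 1\<close> values.\<close>

lemma power8_card_le_E4:
  fixes S :: "(int \<times> int) set" and r j :: nat and M Q \<mu> :: real
  assumes fin: "finite S" and Q: "Q \<ge> 0"
    and m: "\<And>p. p \<in> S \<Longrightarrow> 1 \<le> fst p \<and> real_of_int (fst p) \<le> M"
    and k: "\<And>p. p \<in> S \<Longrightarrow> snd p \<in> modular_sqrts r (int j * fst p)"
    and kQ: "\<And>p. p \<in> S \<Longrightarrow> real_of_int (snd p) \<le> Q"
    and \<mu>: "\<And>m. real (card {p \<in> S. fst p = m}) \<le> \<mu>" and big: "2 * \<mu> \<le> real (card S)"
  shows "real (card S) ^ 8 \<le> 16 * (4 * Q + 1) * real (E4 r j M M)"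
proof -
  define T where "T = {(p, q) \<in> S \<times> S. fst p \<noteq> fst q}"
  define f where "f = (\<lambda>((p :: int \<times> int, q :: int \<times> int), (p' :: int \<times> int, q' :: int \<times> int)). snd p - snd q + snd p' - snd q')"
  have finT: "finite T" unfolding T_def by (rule finite_subset[of _ "S \<times> S"]) (use fin in auto)
  have "S \<times> S - T = (SIGMA p:S. {q \<in> S. fst q = fst p})" by (auto simp: T_def)
  then have "real (card (S \<times> S - T)) = (\<Sum>p\<in>S. real (card {q \<in> S. fst q = fst p}))"
    using fin by (simp add: card_SigmaI)
  also have "\<dots> \<le> real (card S) * \<mu>"
    using sum_mono[of S "\<lambda>p. real (card {q \<in> S. fst q = fst p})" "\<lambda>_. \<mu>"] \<mu> by simp
  finally have 1: "real (card (S \<times> S - T)) \<le> real (card S) * \<mu>" .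
  have "card (S \<times> S) \<le> card (S \<times> S - T) + card T"
  proof -
    have "card (S \<times> S) \<le> card ((S \<times> S - T) \<union> T)" using fin finT by (intro card_mono) auto
    also have "\<dots> \<le> card (S \<times> S - T) + card T" by (rule card_Un_le)
    finally show ?thesis .
  qed
  then have "real (card S) * real (card S) \<le> real (card (S \<times> S - T)) + real (card T)"
    unfolding card_cartesian_product by (simp only: of_nat_mult[symmetric] of_nat_add[symmetric] of_nat_le_iff)
  also have "\<dots> \<le> real (card S) * (real (card S) / 2) + real (card T)"
    using 1 big mult_left_mono[of \<mu> "real (card S) / 2" "real (card S)"] by linarith
  finally have half: "(real (card S))\<^sup>2 \<le> 2 * real (card T)" by (simp add: power2_eq_square)
  have "f ` (T \<times> T) \<subseteq> {- \<lfloor>2 * Q\<rfloor>..\<lfloor>2 * Q\<rfloor>}"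
  proof
    fix y assume "y \<in> f ` (T \<times> T)"
    then obtain t1 t2 where t: "t1 \<in> T" "t2 \<in> T" "y = f (t1, t2)" by auto
    obtain p1 p2 where "t1 = (p1, p2)" by (cases t1)
    moreover obtain p3 p4 where "t2 = (p3, p4)" by (cases t2)
    ultimately have S: "p1 \<in> S" "p2 \<in> S" "p3 \<in> S" "p4 \<in> S"
      and y: "y = snd p1 - snd p2 + snd p3 - snd p4"
      using t by (simp_all add: T_def f_def)
    \<comment> \<open>The roots lie between 0 and \<open>Q\<close>, the lower bound being part of
      \<open>modular_sqrts\<close>. The bound on the number of values thus involves \<open>Q\<close>
      and not \<open>r\<close>.\<close>
    have "real_of_int y \<le> 2 * Q" "- (2 * Q) \<le> real_of_int y"
      using S[THEN kQ] S[THEN k] unfolding y modular_sqrts_def by auto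
    then have "y \<le> \<lfloor>2 * Q\<rfloor>" "- y \<le> \<lfloor>2 * Q\<rfloor>" by (auto simp: le_floor_iff)
    then show "y \<in> {- \<lfloor>2 * Q\<rfloor>..\<lfloor>2 * Q\<rfloor>}" by auto
  qed
  then have "card (f ` (T \<times> T)) \<le> card {- \<lfloor>2 * Q\<rfloor>..\<lfloor>2 * Q\<rfloor>}" by (intro card_mono) auto
  then have card_vals: "card (f ` (T \<times> T)) \<le> nat (2 * \<lfloor>2 * Q\<rfloor> + 1)" by simp
  have "real (card (f ` (T \<times> T))) \<le> real_of_int (2 * \<lfloor>2 * Q\<rfloor> + 1)"
  proof -
    have "0 \<le> \<lfloor>2 * Q\<rfloor>" using Q by simp
    with card_vals show ?thesis by simp linarith
  qed
  also have "\<dots> \<le> 4 * Q + 1" by simp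
  finally have vals: "real (card (f ` (T \<times> T))) \<le> 4 * Q + 1" .
  define n where "n = card {(x, y) \<in> (T \<times> T) \<times> (T \<times> T). f x = f y}"
  have "n \<le> E4 r j M M"
    unfolding n_def by (rule collisions_le_E4[OF m k T_def f_def])
  moreover have "(card (T \<times> T))\<^sup>2 \<le> card (f ` (T \<times> T)) * n"
    unfolding n_def using finT by (intro power2_card_le_card_collisions) auto
  ultimately have "(card (T \<times> T))\<^sup>2 \<le> card (f ` (T \<times> T)) * E4 r j M M"
    by (meson le_trans mult_le_mono2)
  then have "real ((card T) ^ 4) \<le> real (card (f ` (T \<times> T)) * E4 r j M M)"
    unfolding of_nat_le_iff by (simp add: card_cartesian_product power2_eq_square power4_eq_xxxx mult.assoc)
  also have "\<dots> \<le> (4 * Q + 1) * real (E4 r j M M)"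
    using vals by (simp add: mult_right_mono)
  finally have "real (card T) ^ 4 \<le> (4 * Q + 1) * real (E4 r j M M)" by simp
  moreover have "((real (card S))\<^sup>2) ^ 4 \<le> (2 * real (card T)) ^ 4" using half by (intro power_mono) auto
  ultimately show ?thesis
    by (simp add: power_mult_distrib algebra_simps)
qed

section \<open>Fractions with square denominator near a point\<close>

lemma card_multiples_le:
  fixes d n :: nat
  assumes "d > 0"
  shows "real (card {m \<in> {1..n}. d dvd m}) \<le> real n / real d"
proof -
  have "{m \<in> {1..n}. d dvd m} \<subseteq> (\<lambda>k. d * k) ` {1..n div d}"
  proof
    fix m assume "m \<in> {m \<in> {1..n}. d dvd m}"
    then obtain k where k: "m = d * k" "1 \<le> m" "m \<le> n" by auto
    then have "k \<ge> 1" by (cases k) auto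
    moreover have "k \<le> n div d" using k assms by (simp add: less_eq_div_iff_mult_less_eq mult.commute)
    ultimately show "m \<in> (\<lambda>k. d * k) ` {1..n div d}" using k by auto
  qed
  then have "card {m \<in> {1..n}. d dvd m} \<le> card {1..n div d}"
    by (intro surj_card_le) auto
  also have "\<dots> = n div d" by simp
  finally show ?thesis
    by (meson of_nat_div_le_of_nat of_nat_le_iff order_trans)
qed

text \<open>\<open>sqrt (gcd m r)\<close> is one term of the sum of \<open>sqrt d\<close> over
  common divisors \<open>d\<close> of \<open>m\<close> and \<open>r\<close>. After swapping sums,
  each \<open>d\<close> contributes at most \<open>sqrt d * (n / d) \<le> n\<close>.\<close>

lemma sum_sqrt_gcd_le:
  fixes n r :: nat
  assumes "r > 0"
  shows "(\<Sum>m\<in>{1..n}. sqrt (gcd m r)) \<le> real n * card {d. d dvd r}"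
proof -
  have fin: "finite {d. d dvd r}" using assms by simp
  have "(\<Sum>m\<in>{1..n}. sqrt (gcd m r)) \<le> (\<Sum>m\<in>{1..n}. \<Sum>(d::nat)\<in>{d. d dvd r}. if d dvd m then sqrt (real d) else 0)"
  proof (rule sum_mono)
    fix m assume "m \<in> {1..n}"
    have "sqrt (gcd m r) = (if gcd m r dvd m then sqrt (gcd m r) else 0)" by simp
    also have "\<dots> \<le> (\<Sum>(d::nat)\<in>{d. d dvd r}. if d dvd m then sqrt (real d) else 0)"
      by (rule member_le_sum) (use fin in auto)
    finally show "sqrt (gcd m r) \<le> (\<Sum>(d::nat)\<in>{d. d dvd r}. if d dvd m then sqrt (real d) else 0)" .
  qed
  also have "\<dots> = (\<Sum>(d::nat)\<in>{d. d dvd r}. \<Sum>m\<in>{1..n}. if d dvd m then sqrt (real d) else 0)" by (rule sum.swap)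
  also have "\<dots> = (\<Sum>(d::nat)\<in>{d. d dvd r}. sqrt (real d) * real (card {m \<in> {1..n}. d dvd m}))"
    by (intro sum.cong refl) (simp add: sum.If_cases Int_def mult.commute)
  also have "\<dots> \<le> (\<Sum>(d::nat)\<in>{d. d dvd r}. real n)"
  proof (rule sum_mono)
    fix d :: nat assume "d \<in> {d. d dvd r}"
    then have d: "d > 0" using assms by (auto intro: Nat.gr0I)
    have "sqrt (real d) \<le> real d" using d by (intro real_le_lsqrt self_le_power) auto
    then have "sqrt (real d) * real (card {m \<in> {1..n}. d dvd m}) \<le> real d * (real n / real d)"
      using card_multiples_le[OF d] by (intro mult_mono) auto
    then show "sqrt (real d) * real (card {m \<in> {1..n}. d dvd m}) \<le> real n" using d by simp
  qed
  finally show ?thesis by (simp add: mult.commute)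
qed

text \<open>Numerators range over all integers, so distance is measured on the real line; the
  passage modulo 1 is made when the Farey fractions are mapped into this set.\<close>

definition near_fractions :: "real \<Rightarrow> real \<Rightarrow> (int \<times> int) set" where
  "near_fractions Q \<alpha> = {(q, a). 1 \<le> q \<and> real_of_int q \<le> Q \<and> coprime q a \<and>
     \<bar>real_of_int a / real_of_int (q\<^sup>2) - \<alpha>\<bar> \<le> 1 / Q ^ 3}"

text \<open>As \<open>q^2 \<le> Q^3\<close>, the numerator is within 1 of
  \<open>\<alpha> * q^2\<close>. This yields finiteness and the trivial bound
  \<open>4 * Q\<close>.\<close>

lemma near_fractions_subset:
  assumes "Q \<ge> 1"
  shows "near_fractions Q \<alpha> \<subseteq> (SIGMA q:{1..\<lfloor>Q\<rfloor>}. {\<lfloor>\<alpha> * real_of_int (q\<^sup>2)\<rfloor> - 1..\<lfloor>\<alpha> * real_of_int (q\<^sup>2)\<rfloor> + 2})"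
proof
  fix p assume "p \<in> near_fractions Q \<alpha>"
  then obtain q a where p: "p = (q, a)" "1 \<le> q" "real_of_int q \<le> Q"
    "\<bar>real_of_int a / real_of_int (q\<^sup>2) - \<alpha>\<bar> \<le> 1 / Q ^ 3" by (auto simp: near_fractions_def)
  define w where "w = real_of_int (q\<^sup>2)"
  have w: "w > 0" using p by (simp add: w_def)
  have "w \<le> Q ^ 2" using p unfolding w_def by (simp add: power_mono)
  also have "\<dots> \<le> Q ^ 3" using assms by (intro power_increasing) auto
  finally have wQ: "w \<le> Q ^ 3" .
  have "\<bar>real_of_int a - \<alpha> * w\<bar> = w * \<bar>real_of_int a / w - \<alpha>\<bar>"
    using w by (simp add: abs_mult_pos[symmetric] abs_mult[symmetric] field_simps)
  also have "\<dots> \<le> w * (1 / Q ^ 3)" using p(4) w unfolding w_def by (intro mult_left_mono) auto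
  also have "\<dots> \<le> 1" using wQ assms by simp
  finally have "\<bar>real_of_int a - \<alpha> * w\<bar> \<le> 1" .
  then have "a \<in> {\<lfloor>\<alpha> * w\<rfloor> - 1..\<lfloor>\<alpha> * w\<rfloor> + 2}" by (simp add: abs_le_iff) linarith
  then show "p \<in> (SIGMA q:{1..\<lfloor>Q\<rfloor>}. {\<lfloor>\<alpha> * real_of_int (q\<^sup>2)\<rfloor> - 1..\<lfloor>\<alpha> * real_of_int (q\<^sup>2)\<rfloor> + 2})"
    using p by (simp add: w_def le_floor_iff)
qed

lemma finite_near_fractions: "Q \<ge> 1 \<Longrightarrow> finite (near_fractions Q \<alpha>)"
  by (rule finite_subset[OF near_fractions_subset]) auto

lemma card_near_fractions_le: 
  assumes "Q \<ge> 1"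
  shows "real (card (near_fractions Q \<alpha>)) \<le> 4 * Q"
proof -
  have "card (near_fractions Q \<alpha>) \<le> card (SIGMA q:{1..\<lfloor>Q\<rfloor>}. {\<lfloor>\<alpha> * real_of_int (q\<^sup>2)\<rfloor> - 1..\<lfloor>\<alpha> * real_of_int (q\<^sup>2)\<rfloor> + 2})"
    using near_fractions_subset[OF assms] by (intro card_mono) auto
  also have "\<dots> = 4 * nat \<lfloor>Q\<rfloor>" by (subst card_SigmaI) auto
  finally have "real (card (near_fractions Q \<alpha>)) \<le> real (4 * nat \<lfloor>Q\<rfloor>)" by (simp only: of_nat_le_iff)
  also have "\<dots> \<le> 4 * Q" using assms by simp
  finally show ?thesis .
qed

section \<open>Fractions near \<open>\<alpha>\<close> seen from a reduced fraction
  \<open>b / r\<close>\<close>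

locale diophantine_approximation =
  fixes Q \<alpha> :: real and b :: int and r :: nat
  assumes Q1: "Q \<ge> 1" and r0: "r > 0" and coprime_b: "coprime b (int r)"
begin

text \<open>The numerator of \<open>a / q^2 - b / r\<close> over the denominator
  \<open>r * q^2\<close>.\<close>

definition residual :: "int \<times> int \<Rightarrow> int" where
  "residual = (\<lambda>(q, a). a * int r - b * q\<^sup>2)"

abbreviation z :: real where "z \<equiv> \<alpha> - b / r"
abbreviation \<tau> :: real where "\<tau> \<equiv> real (card {d. d dvd r})"

lemma residual_eq:
  fixes q a :: int
  assumes "(q, a) \<in> near_fractions Q \<alpha>"
  obtains \<theta> where "\<bar>\<theta>\<bar> \<le> 1 / Q ^ 3" "real_of_int (residual (q, a)) = r * (real_of_int q)\<^sup>2 * (z + \<theta>)"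
proof -
  have q: "real_of_int q > 0" using assms by (simp add: near_fractions_def)
  show ?thesis
  proof (rule that[of "real_of_int a / real_of_int (q\<^sup>2) - \<alpha>"])
    show "real_of_int (residual (q, a)) = r * (real_of_int q)\<^sup>2 * (z + (real_of_int a / real_of_int (q\<^sup>2) - \<alpha>))"
      using q r0 by (simp add: residual_def field_simps)
  qed (use assms in \<open>simp add: near_fractions_def\<close>)
qed

lemma abs_residual_le:
  assumes "p \<in> near_fractions Q \<alpha>"
  shows "\<bar>real_of_int (residual p)\<bar> \<le> r * Q\<^sup>2 * (\<bar>z\<bar> + 1 / Q ^ 3)"
proof -
  obtain q a where p: "p = (q, a)" by (cases p)
  obtain \<theta> where \<theta>: "\<bar>\<theta>\<bar> \<le> 1 / Q ^ 3" "real_of_int (residual (q, a)) = r * (real_of_int q)\<^sup>2 * (z + \<theta>)"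
    using residual_eq assms p by blast
  have q: "1 \<le> q" "real_of_int q \<le> Q" using assms p by (auto simp: near_fractions_def)
  have "\<bar>real_of_int (residual p)\<bar> = r * (real_of_int q)\<^sup>2 * \<bar>z + \<theta>\<bar>"
    unfolding p \<theta>(2) by (simp add: abs_mult)
  also have "\<dots> \<le> r * Q\<^sup>2 * (\<bar>z\<bar> + 1 / Q ^ 3)"
    using \<theta>(1) q by (intro mult_mono power_mono) auto
  finally show ?thesis .
qed

text \<open>Here \<open>a / q^2\<close> equals \<open>b / r\<close> and both are in lowest terms, so
  \<open>r = q^2\<close> and \<open>a = b\<close>.\<close>

lemma card_residual_0_le: "card {p \<in> near_fractions Q \<alpha>. residual p = 0} \<le> 1"
proof -
  have *: "int r = q\<^sup>2 \<and> a = b" if "(q, a) \<in> near_fractions Q \<alpha>" "residual (q, a) = 0" for q a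
  proof -
    have q: "q \<ge> 1" "coprime q a" using that by (auto simp: near_fractions_def)
    have eq: "a * int r = b * q\<^sup>2" using that by (simp add: residual_def)
    have "int r dvd q\<^sup>2" using eq coprime_b
      by (metis coprime_commute coprime_dvd_mult_right_iff dvd_triv_right)
    moreover have "q\<^sup>2 dvd int r" using eq q
      by (metis coprime_dvd_mult_right_iff coprime_power_left_iff dvd_triv_right)
    ultimately have "int r = q\<^sup>2" by (simp add: zdvd_antisym_nonneg)
    with eq q show ?thesis by simp
  qed
  have "is_singleton {p \<in> near_fractions Q \<alpha>. residual p = 0} \<or> {p \<in> near_fractions Q \<alpha>. residual p = 0} = {}"
  proof (cases "{p \<in> near_fractions Q \<alpha>. residual p = 0} = {}")
    case False
    have "p = p'" if "p \<in> near_fractions Q \<alpha>" "residual p = 0" "p' \<in> near_fractions Q \<alpha>" "residual p' = 0" for p p'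
    proof -
      obtain q a q' a' where p: "p = (q, a)" "p' = (q', a')" by (cases p, cases p')
      have "q\<^sup>2 = q'\<^sup>2" "a = a'" using *[of q a] *[of q' a'] that p by auto
      moreover have "q \<ge> 1" "q' \<ge> 1" using that p by (auto simp: near_fractions_def)
      ultimately show ?thesis using p by (simp add: power2_eq_iff_nonneg)
    qed
    then show ?thesis using False by (intro disjI1 is_singletonI') auto
  qed simp
  then show ?thesis unfolding is_singleton_altdef
    by (elim disjE; simp only: card.empty order_refl zero_le_one)
qed

lemma inj_on_residual_fst: "inj_on (\<lambda>p. (residual p, fst p)) S"
  using r0 by (auto simp: inj_on_def residual_def)

text \<open>Equating the two expressions for \<open>m\<close> bounds
  \<open>(q2 - q1) * \<bar>z\<bar>\<close> by \<open>2 Q / Q^3\<close>, while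
  \<open>\<bar>m\<bar> \<ge> 1\<close> forces
  \<open>1 \<le> r Q^2 (\<bar>z\<bar> + 1 / Q^3)\<close>. Multiplying the latter by
  \<open>q2 - q1\<close> gives \<open>3 r\<close>, whatever the size of \<open>z\<close>.\<close>

lemma near_fractions_same_residual_diff:
  assumes "(q1, a1) \<in> near_fractions Q \<alpha>" "(q2, a2) \<in> near_fractions Q \<alpha>"
    and "residual (q1, a1) = m" "residual (q2, a2) = m" "m \<noteq> 0"
  shows "real_of_int (q2 - q1) \<le> 3 * real r"
proof (cases "q1 < q2")
  case True
  define x y D where "x = real_of_int q1" and "y = real_of_int q2" and "D = 1 / Q ^ 3"
  have D0: "D > 0" using Q1 by (simp add: D_def)
  have xy: "1 \<le> x" "x < y" "y \<le> Q" using True assms by (auto simp: near_fractions_def x_def y_def)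
  obtain s where s: "\<bar>s\<bar> \<le> D" "real_of_int m = r * x\<^sup>2 * (z + s)"
    using residual_eq[OF assms(1)] assms(3) unfolding D_def x_def by auto
  obtain t where t: "\<bar>t\<bar> \<le> D" "real_of_int m = r * y\<^sup>2 * (z + t)"
    using residual_eq[OF assms(2)] assms(4) unfolding D_def y_def by auto
  have "real r * (x\<^sup>2 * (z + s)) = real r * (y\<^sup>2 * (z + t))" using s(2) t(2) by (simp only: mult.assoc)
  then have "x\<^sup>2 * (z + s) = y\<^sup>2 * (z + t)" using r0 by simp
  then have "(y\<^sup>2 - x\<^sup>2) * z = x\<^sup>2 * s - y\<^sup>2 * t" by (simp add: algebra_simps)
  then have "(y\<^sup>2 - x\<^sup>2) * \<bar>z\<bar> = \<bar>x\<^sup>2 * s - y\<^sup>2 * t\<bar>"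
    using xy by (metis abs_mult abs_of_nonneg diff_ge_0_iff_ge less_eq_real_def order_trans power_mono zero_le_one)
  also have "\<dots> \<le> x\<^sup>2 * \<bar>s\<bar> + y\<^sup>2 * \<bar>t\<bar>"
    using abs_triangle_ineq4[of "x\<^sup>2 * s" "y\<^sup>2 * t"] by (simp add: abs_mult)
  also have "\<dots> \<le> x\<^sup>2 * D + y\<^sup>2 * D"
    using s(1) t(1) by (intro add_mono mult_left_mono) auto
  \<comment> \<open>Enlarging \<open>x^2 + y^2\<close> to a square lets the factor
    \<open>y + x\<close> of \<open>y^2 - x^2\<close> cancel.\<close>
  also have "\<dots> \<le> (y + x)\<^sup>2 * D"
    using D0 xy by (simp add: power2_sum distrib_right)
  finally have "(y + x) * ((y - x) * \<bar>z\<bar>) \<le> (y + x) * ((y + x) * D)"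
    by (simp add: power2_eq_square algebra_simps)
  then have "(y - x) * \<bar>z\<bar> \<le> (y + x) * D" using xy by simp
  also have "\<dots> \<le> 2 * Q * D" using xy D0 by (intro mult_right_mono) auto
  finally have zle: "(y - x) * \<bar>z\<bar> \<le> 2 * Q * D" .
  have Dle: "(y - x) * D \<le> Q * D" using xy D0 by (intro mult_right_mono) auto
  have "1 \<le> \<bar>real_of_int m\<bar>" using assms(5) by (simp flip: of_int_abs)
  also have "\<dots> \<le> r * Q\<^sup>2 * (\<bar>z\<bar> + D)"
    using abs_residual_le[OF assms(1)] assms(3) unfolding D_def by simp
  finally have one: "1 \<le> r * Q\<^sup>2 * (\<bar>z\<bar> + D)" .
  have "y - x \<le> (y - x) * (r * Q\<^sup>2 * (\<bar>z\<bar> + D))"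
    using mult_left_mono[OF one, of "y - x"] xy by simp
  also have "\<dots> = r * Q\<^sup>2 * ((y - x) * \<bar>z\<bar> + (y - x) * D)" by (simp add: algebra_simps)
  also have "\<dots> \<le> r * Q\<^sup>2 * (2 * Q * D + Q * D)"
    using zle Dle by (intro mult_left_mono add_mono) auto
  also have "\<dots> = 3 * r * (Q ^ 3 * D)" by (simp add: power2_eq_square power3_eq_cube algebra_simps)
  also have "Q ^ 3 * D = 1" using Q1 by (simp add: D_def)
  finally show ?thesis by (simp add: x_def y_def)
qed (use r0 in linarith)

text \<open>The residual is \<open>- b * q^2\<close> modulo \<open>r\<close>, and \<open>b\<close>
  is a unit there. Hence all \<open>q\<close> with the same residual share the same
  \<open>gcd (q^2) r\<close>, as the count of square roots requires.\<close>

lemma gcd_residual: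
  "gcd (residual (q, a)) (int r) = gcd (q\<^sup>2) (int r)"
proof -
  have "gcd (residual (q, a)) (int r) = gcd (int r) (- (b * q\<^sup>2) + a * int r)"
    by (simp add: residual_def gcd.commute)
  also have "\<dots> = gcd (b * q\<^sup>2) (int r)" by (metis gcd.commute gcd_add_mult mult.commute add.commute gcd_neg1_int)
  also have "\<dots> = gcd (q\<^sup>2) (int r)"
    using coprime_b by (metis coprime_commute gcd.commute gcd_mult_right_left_cancel)
  finally show ?thesis .
qed

lemma residual_cong: "[residual (q, a) = - (b * q\<^sup>2)] (mod int r)"
  by (simp add: residual_def cong_iff_dvd_diff)

text \<open>For fixed \<open>m\<close> all \<open>q^2\<close> agree modulo \<open>r\<close> because
  \<open>b\<close> is invertible, and the \<open>q\<close> lie in an interval of length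
  \<open>3 r\<close>. The count of square roots with \<open>B = 3\<close> gives the constant
  \<open>8 = (3 + 1) * 2\<close>.\<close>

lemma card_residual_eq_le:
  assumes "m \<noteq> 0"
  shows "real (card {p \<in> near_fractions Q \<alpha>. residual p = m}) \<le> 8 * sqrt (gcd m (int r)) * \<tau>"
proof -
  define F where "F = {p \<in> near_fractions Q \<alpha>. residual p = m}"
  have finF: "finite F" using finite_near_fractions[OF Q1] by (simp add: F_def)
  have inj: "inj_on fst F"
    using inj_on_residual_fst[of F] by (auto simp: inj_on_def F_def)
  have "real (card (fst ` F)) \<le> (3 + 1) * 2 * sqrt (real_of_int (gcd m (int r))) * real (card {d. d dvd r})"
  proof (rule card_square_roots_le)
    fix x y assume "x \<in> fst ` F" "y \<in> fst ` F"
    then obtain a c where xy: "(x, a) \<in> near_fractions Q \<alpha>" "residual (x, a) = m"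
      "(y, c) \<in> near_fractions Q \<alpha>" "residual (y, c) = m" by (auto simp: F_def)
    have "[- (b * x\<^sup>2) = - (b * y\<^sup>2)] (mod int r)"
      using residual_cong[of x a] residual_cong[of y c] xy by (metis cong_sym cong_trans)
    then have "[b * x\<^sup>2 = b * y\<^sup>2] (mod int r)" by (simp add: cong_minus_minus_iff)
    then show "[x\<^sup>2 = y\<^sup>2] (mod int r)" using coprime_b by (simp add: cong_mult_lcancel)
    show "real_of_int (x - y) \<le> 3 * real r"
      by (rule near_fractions_same_residual_diff[OF xy(3,1,4,2) assms])
  next
    fix x assume "x \<in> fst ` F"
    then obtain a where "residual (x, a) = m" by (auto simp: F_def)
    then show "real_of_int (gcd (x\<^sup>2) (int r)) = real_of_int (gcd m (int r))"
      using gcd_residual[of x a] by simp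
  qed (use finF r0 in auto)
  also have "card (fst ` F) = card F" by (rule card_image[OF inj])
  finally show ?thesis by (simp add: F_def)
qed

text \<open>\<open>E4\<close> counts positive \<open>m\<close> only; the sign
  \<open>\<sigma>\<close> reduces negative residuals to that case.\<close>

definition signed_part :: "int \<Rightarrow> (int \<times> int) set" where
  "signed_part \<sigma> = {p \<in> near_fractions Q \<alpha>. \<sigma> * residual p \<ge> 1}"

lemma finite_signed_part: "finite (signed_part \<sigma>)"
  using finite_near_fractions[OF Q1] by (simp add: signed_part_def)

lemma card_near_fractions_split:
  "real (card (near_fractions Q \<alpha>)) \<le> 1 + card (signed_part 1) + card (signed_part (- 1))"
proof -
  let ?Z = "{p \<in> near_fractions Q \<alpha>. residual p = 0}"
  have "near_fractions Q \<alpha> \<subseteq> ?Z \<union> signed_part 1 \<union> signed_part (- 1)"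
    by (auto simp: signed_part_def)
  then have "card (near_fractions Q \<alpha>) \<le> card (?Z \<union> signed_part 1 \<union> signed_part (- 1))"
    using finite_near_fractions[OF Q1] finite_signed_part by (intro card_mono) auto
  also have "\<dots> \<le> card ?Z + card (signed_part 1) + card (signed_part (- 1))"
    by (meson add_le_mono1 card_Un_le le_trans)
  finally show ?thesis using card_residual_0_le by linarith
qed

text \<open>Summing the bound for a single residual over all \<open>m \<le> U\<close>: one
  \<open>\<tau>\<close> comes from each fibre, the other from the average of
  \<open>sqrt (gcd m r)\<close>.\<close>

lemma card_signed_part_le:
  assumes \<sigma>: "\<sigma> \<in> {1, - 1}" and U: "\<And>p. p \<in> near_fractions Q \<alpha> \<Longrightarrow> \<bar>real_of_int (residual p)\<bar> \<le> U"
    and U0: "U \<ge> 0"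
  shows "real (card (signed_part \<sigma>)) \<le> 8 * U * \<tau>\<^sup>2"
proof -
  define n where "n = nat \<lfloor>U\<rfloor>"
  have "signed_part \<sigma> \<subseteq> (\<Union>m\<in>{1..n}. {p \<in> near_fractions Q \<alpha>. residual p = \<sigma> * int m})"
  proof
    fix p assume "p \<in> signed_part \<sigma>"
    then have p: "p \<in> near_fractions Q \<alpha>" "\<sigma> * residual p \<ge> 1" by (auto simp: signed_part_def)
    have "\<bar>residual p\<bar> \<le> \<lfloor>U\<rfloor>" using U[OF p(1)] by (simp add: le_floor_iff)
    moreover have "\<bar>residual p\<bar> = \<sigma> * residual p" using \<sigma> p(2) by auto
    ultimately have "nat (\<sigma> * residual p) \<in> {1..n}" using p(2) unfolding n_def by auto
    moreover have "residual p = \<sigma> * int (nat (\<sigma> * residual p))" using p(2) \<sigma> by auto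
    ultimately show "p \<in> (\<Union>m\<in>{1..n}. {p \<in> near_fractions Q \<alpha>. residual p = \<sigma> * int m})"
      using p(1) by blast
  qed
  then have "card (signed_part \<sigma>) \<le> card (\<Union>m\<in>{1..n}. {p \<in> near_fractions Q \<alpha>. residual p = \<sigma> * int m})"
    using finite_near_fractions[OF Q1] by (intro card_mono) auto
  also have "\<dots> \<le> (\<Sum>m\<in>{1..n}. card {p \<in> near_fractions Q \<alpha>. residual p = \<sigma> * int m})"
    by (intro card_UN_le) auto
  finally have "real (card (signed_part \<sigma>)) \<le> real (\<Sum>m\<in>{1..n}. card {p \<in> near_fractions Q \<alpha>. residual p = \<sigma> * int m})"
    by (simp only: of_nat_le_iff)
  also have "\<dots> \<le> (\<Sum>m\<in>{1..n}. 8 * sqrt (gcd m r) * \<tau>)"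
    unfolding of_nat_sum
  proof (rule sum_mono)
    fix m assume m: "m \<in> {1..n}"
    have "gcd (\<sigma> * int m) (int r) = int (gcd m r)" using \<sigma> by auto
    then show "real (card {p \<in> near_fractions Q \<alpha>. residual p = \<sigma> * int m}) \<le> 8 * sqrt (gcd m r) * \<tau>"
      using card_residual_eq_le[of "\<sigma> * int m"] m \<sigma> by auto
  qed
  also have "\<dots> = 8 * \<tau> * (\<Sum>m\<in>{1..n}. sqrt (gcd m r))" by (simp add: sum_distrib_left mult_ac)
  also have "\<dots> \<le> 8 * \<tau> * (real n * \<tau>)" by (intro mult_left_mono sum_sqrt_gcd_le[OF r0]) auto
  also have "\<dots> = 8 * real n * \<tau>\<^sup>2" by (simp add: power2_eq_square)
  also have "\<dots> \<le> 8 * U * \<tau>\<^sup>2" using U0 by (intro mult_right_mono) (auto simp: n_def)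
  finally show ?thesis .
qed

text \<open>With \<open>j\<close> congruent to \<open>- \<sigma>\<close> times the inverse of
  \<open>b\<close>, each \<open>q\<close> is a square root of
  \<open>j * (\<sigma> * residual)\<close> modulo \<open>r\<close>. Since \<open>Q < r\<close>, it
  is its own canonical representative.\<close>

lemma signed_part_energy:
  assumes \<sigma>: "\<sigma> \<in> {1, - 1}" and U: "\<And>p. p \<in> near_fractions Q \<alpha> \<Longrightarrow> \<bar>real_of_int (residual p)\<bar> \<le> U"
    and U0: "U \<ge> 0" and Qr: "Q < r" and big: "16 * sqrt U * \<tau> \<le> real (card (signed_part \<sigma>))"
  obtains j where "j \<ge> 1" "coprime r j"
    "real (card (signed_part \<sigma>)) ^ 8 \<le> 16 * (4 * Q + 1) * real (E4 r j U U)"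
proof -
  obtain x where x: "[b * x = 1] (mod int r)"
    using coprime_b cong_solve_coprime_int by blast
  \<comment> \<open>Adding \<open>r\<close> keeps the residue class and ensures
    \<open>j \<ge> 1\<close>.\<close>
  define j where "j = nat ((- \<sigma> * x) mod int r) + r"
  have j1: "j \<ge> 1" using r0 by (simp add: j_def)
  have "int j = (- \<sigma> * x) mod int r + int r" using r0 by (simp add: j_def)
  then have "[int j = - \<sigma> * x] (mod int r)" by (simp add: cong_def)
  then have "[b * int j = b * (- \<sigma> * x)] (mod int r)" by (rule cong_scalar_left)
  also have "b * (- \<sigma> * x) = - \<sigma> * (b * x)" by simp
  also have "[- \<sigma> * (b * x) = - \<sigma> * 1] (mod int r)" using x by (rule cong_scalar_left)
  finally have bj: "[b * int j = - \<sigma>] (mod int r)" by simp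
  have \<sigma>2: "\<sigma> * \<sigma> = 1" using \<sigma> by auto
  have "[int j * (- \<sigma> * b) = - \<sigma> * - \<sigma>] (mod int r)"
    using cong_scalar_left[OF bj, of "- \<sigma>"] by (simp add: mult_ac)
  then have "[int j * (- \<sigma> * b) = 1] (mod int r)" by (simp add: \<sigma>2)
  then have "coprime (int j) (int r)" using coprime_iff_invertible_int by blast
  then have cop: "coprime r j" by (simp add: coprime_commute)
  define g where "g = (\<lambda>p. (\<sigma> * residual p, fst p))"
  define S where "S = g ` signed_part \<sigma>"
  have injg: "inj_on g A" for A
    using inj_on_residual_fst[of A] \<sigma> by (auto simp: inj_on_def g_def)
  have cardS: "card S = card (signed_part \<sigma>)" unfolding S_def by (rule card_image[OF injg])
  have "real (card S) ^ 8 \<le> 16 * (4 * Q + 1) * real (E4 r j U U)"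
  \<comment> \<open>This is the bound for one residual \<open>m\<close>, with
    \<open>gcd m r \<le> m \<le> U\<close>.\<close>
  proof (rule power8_card_le_E4[where \<mu> = "8 * sqrt U * \<tau>"])
    show "finite S" using finite_signed_part by (simp add: S_def)
    show "Q \<ge> 0" using Q1 by simp
    show "2 * (8 * sqrt U * \<tau>) \<le> real (card S)" using big by (simp add: cardS)
  next
    fix p assume "p \<in> S"
    then obtain q a where qa: "(q, a) \<in> signed_part \<sigma>" "p = (\<sigma> * residual (q, a), q)"
      by (auto simp: S_def g_def)
    then have nf: "(q, a) \<in> near_fractions Q \<alpha>" and pos: "\<sigma> * residual (q, a) \<ge> 1" by (auto simp: signed_part_def)
    have "\<sigma> * residual (q, a) = \<bar>residual (q, a)\<bar>" using pos \<sigma> by auto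
    then have "real_of_int (\<sigma> * residual (q, a)) \<le> U" using U[OF nf] by simp
    then show "1 \<le> fst p \<and> real_of_int (fst p) \<le> U" using qa pos by simp
    have q: "1 \<le> q" "real_of_int q \<le> Q" using nf by (auto simp: near_fractions_def)
    then show "real_of_int (snd p) \<le> Q" using qa by simp
    have "[int j * (\<sigma> * residual (q, a)) = int j * (\<sigma> * - (b * q\<^sup>2))] (mod int r)"
      by (intro cong_scalar_left residual_cong)
    also have "int j * (\<sigma> * - (b * q\<^sup>2)) = (- \<sigma> * q\<^sup>2) * (b * int j)" by simp
    also have "[(- \<sigma> * q\<^sup>2) * (b * int j) = (- \<sigma> * q\<^sup>2) * - \<sigma>] (mod int r)"
      using bj by (rule cong_scalar_left)
    also have "(- \<sigma> * q\<^sup>2) * - \<sigma> = q\<^sup>2" using \<sigma>2 by (metis minus_mult_minus mult.assoc mult.commute mult_1)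
    finally have "[q\<^sup>2 = int j * (\<sigma> * residual (q, a))] (mod int r)" by (rule cong_sym)
    moreover have "q < int r" using q Qr by linarith
    ultimately show "snd p \<in> modular_sqrts r (int j * fst p)" using q qa by (simp add: modular_sqrts_def)
  next
    fix m
    show "real (card {p \<in> S. fst p = m}) \<le> 8 * sqrt U * \<tau>"
    proof (cases "{p \<in> S. fst p = m} = {}")
      case True
      show ?thesis unfolding True using U0 by simp
    next
      case False
      then obtain p0 where p0: "p0 \<in> signed_part \<sigma>" "m = \<sigma> * residual p0" by (auto simp: S_def g_def)
      have m1: "m \<ge> 1" using p0 by (auto simp: signed_part_def)
      have mU: "real_of_int m \<le> U"
        using U[of p0] p0 \<sigma> by (auto simp: signed_part_def)
      have sub: "{p \<in> S. fst p = m} \<subseteq> g ` {p \<in> near_fractions Q \<alpha>. residual p = \<sigma> * m}"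
        using \<sigma> by (auto simp: S_def g_def signed_part_def)
      have "card {p \<in> S. fst p = m} \<le> card {p \<in> near_fractions Q \<alpha>. residual p = \<sigma> * m}"
        using finite_near_fractions[OF Q1] by (intro surj_card_le[OF _ sub]) auto
      then have "real (card {p \<in> S. fst p = m}) \<le> 8 * sqrt (gcd (\<sigma> * m) (int r)) * \<tau>"
        using card_residual_eq_le[of "\<sigma> * m"] m1 \<sigma> by force
      also have "\<dots> \<le> 8 * sqrt U * \<tau>"
      proof -
        have "gcd (\<sigma> * m) (int r) = gcd m (int r)" using \<sigma> by auto
        also have "\<dots> \<le> m" using m1 by (intro zdvd_imp_le) auto
        finally have "real_of_int (gcd (\<sigma> * m) (int r)) \<le> U" using mU by linarith
        then show ?thesis by (intro mult_right_mono mult_left_mono) auto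
      qed
      finally show ?thesis .
    qed
  qed
  then show ?thesis using that[OF j1 cop] cardS by simp
qed

end

section \<open>Choice of exponents and the bound for fractions near a point\<close>

lemma diophantine_approximation_exists:
  fixes \<alpha> R :: real
  assumes "R \<ge> 1"
  obtains b :: int and r :: nat where "r > 0" "coprime b (int r)" "real r \<le> R"
    "real r * \<bar>\<alpha> - b / r\<bar> \<le> 2 / R"
proof -
  define N where "N = nat \<lfloor>R\<rfloor>"
  have fl: "\<lfloor>R\<rfloor> \<ge> 1" using assms by (simp add: le_floor_iff)
  \<comment> \<open>Dirichlet's theorem needs an integer; rounding \<open>R\<close> down costs the
    factor 2 in the conclusion.\<close>
  then have N: "N > 0" "real N \<le> R" "R \<le> 2 * real N" unfolding N_def using assms by (simp, simp, linarith)
  obtain h k where hk: "coprime h k" "0 < k" "k \<le> int N" "\<bar>of_int k * \<alpha> - of_int h\<bar> < 1 / real N"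
    using Dirichlet_approx_coprime[OF N(1)] by blast
  show ?thesis
  proof (rule that[of "nat k" h])
    show "nat k > 0" "coprime h (int (nat k))" using hk by auto
    show "real (nat k) \<le> R" using hk(2,3) N(2) by linarith
    have "real (nat k) * \<bar>\<alpha> - h / real (nat k)\<bar> = \<bar>real (nat k) * (\<alpha> - h / real (nat k))\<bar>"
      by (simp add: abs_mult)
    also have "\<dots> = \<bar>of_int k * \<alpha> - of_int h\<bar>" using hk(2) by (simp add: right_diff_distrib)
    also have "\<dots> \<le> 1 / real N" using hk(4) by simp
    also have "\<dots> \<le> 2 / R" using N assms by (simp add: field_simps)
    finally show "real (nat k) * \<bar>\<alpha> - h / real (nat k)\<bar> \<le> 2 / R" .
  qed
qed

text \<open>The assumption of the final theorem for one fixed \<open>\<nu>\<close>.\<close>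

definition energy_bound :: "real \<Rightarrow> bool" where
  "energy_bound \<nu> \<longleftrightarrow> (\<forall>\<epsilon>::real. \<epsilon> > 0 \<longrightarrow>
      (\<exists>C::real. \<forall>(r::nat) (j::nat) (M::real) (H::real).
         r \<ge> 1 \<longrightarrow> j \<ge> 1 \<longrightarrow> coprime r j \<longrightarrow> 1 \<le> H \<longrightarrow> H \<le> M \<longrightarrow> M \<le> real r \<longrightarrow>
         real (E4 r j M H) \<le>
           C * H powr (2 - \<nu>) * M ^ 2 * (H ^ 3 * M ^ 2 / real r + H * M) * real r powr \<epsilon>))"

text \<open>The constant is \<open>20412 = 9 * 9 * (243 + 9)\<close>.\<close>

lemma E4_le_powr:
  fixes Q \<nu> \<delta> C :: real and r :: nat
  assumes \<nu>: "0 < \<nu>" "\<nu> \<le> \<nu>'" "\<nu> \<le> 1" and \<delta>: "\<delta> = \<nu> / 40" and C: "C \<ge> 1" and Q: "Q \<ge> 16"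
    and r: "Q powr (3/2 - \<delta>) \<le> r" "r \<le> Q powr (3/2 + \<delta>)" and U: "U = 3 * Q powr (1/2 + \<delta>)"
    and E: "real (E4 r j U U) \<le> C * U powr (2 - \<nu>') * U ^ 2 * (U ^ 3 * U ^ 2 / real r + U * U) * real r powr \<delta>"
  shows "real (E4 r j U U) \<le> C * 20412 * Q powr (3 - \<nu> / 5)"
proof -
  have Q0: "Q > 0" "Q \<ge> 1" using Q by auto
  have r0: "real r > 0" using r(1) Q0 by (smt (verit) powr_gt_zero)
  have "Q powr (1/2 + \<delta>) \<ge> 1" using Q0 \<nu> \<delta> by (intro ge_one_powr_ge_zero) auto
  then have U1: "U \<ge> 1" unfolding U by simp
  have Upow: "U ^ n = 3 ^ n * Q powr (real n * (1/2 + \<delta>))" for n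
    using Q0 unfolding U by (simp add: power_mult_distrib powr_powr powr_realpow[symmetric] mult.commute)
  have "U powr (2 - \<nu>') \<le> U powr (2 - \<nu>)" using U1 \<nu> by (intro powr_mono) auto
  also have "\<dots> = 3 powr (2 - \<nu>) * Q powr ((1/2 + \<delta>) * (2 - \<nu>))"
    using Q0 unfolding U by (simp add: powr_mult powr_powr)
  also have "\<dots> \<le> 3 powr 2 * Q powr (1 - \<nu> / 2 + 2 * \<delta>)"
  proof (intro mult_mono powr_mono)
    have "(1/2 + \<delta>) * (2 - \<nu>) = 1 - \<nu> / 2 + 2 * \<delta> - \<delta> * \<nu>"
      by (simp add: algebra_simps diff_divide_distrib)
    also have "\<dots> \<le> 1 - \<nu> / 2 + 2 * \<delta>" using \<nu> \<delta> by simp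
    finally show "(1/2 + \<delta>) * (2 - \<nu>) \<le> 1 - \<nu> / 2 + 2 * \<delta>" .
  qed (use \<nu> Q0 in auto)
  finally have e1: "U powr (2 - \<nu>') \<le> 9 * Q powr (1 - \<nu> / 2 + 2 * \<delta>)" by simp
  have e2: "U ^ 2 = 9 * Q powr (1 + 2 * \<delta>)" using Upow[of 2] by (simp add: algebra_simps)
  \<comment> \<open>The lower bound for \<open>r\<close> enters here: it brings this term down to
    the order of the second term \<open>U * U\<close>, up to a power
    \<open>Q powr (4 * \<delta>)\<close>.\<close>
  have "U ^ 3 * U ^ 2 / real r \<le> 243 * Q powr (5/2 + 5 * \<delta>) / Q powr (3/2 - \<delta>)"
    using Upow[of 5] r(1) Q0 r0 by (intro frac_le) (auto simp: power_add[symmetric] algebra_simps)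
  also have "\<dots> = 243 * Q powr ((5/2 + 5 * \<delta>) - (3/2 - \<delta>))"
    by (simp only: powr_diff times_divide_eq_right)
  also have "(5/2 + 5 * \<delta>) - (3/2 - \<delta>) = 1 + 6 * \<delta>" by simp
  finally have e3: "U ^ 3 * U ^ 2 / real r \<le> 243 * Q powr (1 + 6 * \<delta>)" .
  have "U * U = 9 * Q powr (1 + 2 * \<delta>)" using e2 by (simp add: power2_eq_square)
  also have "\<dots> \<le> 9 * Q powr (1 + 6 * \<delta>)" using Q0 \<nu> \<delta> by (intro mult_left_mono powr_mono) auto
  finally have e4: "U * U \<le> 9 * Q powr (1 + 6 * \<delta>)" .
  have "real r powr \<delta> \<le> (Q powr (3/2 + \<delta>)) powr \<delta>" using r r0 \<nu> \<delta> by (intro powr_mono2) auto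
  also have "\<dots> = Q powr ((3/2 + \<delta>) * \<delta>)" by (simp add: powr_powr)
  also have "\<dots> \<le> Q powr (2 * \<delta>)" using Q0 \<nu> \<delta> by (intro powr_mono mult_right_mono) auto
  finally have e5: "real r powr \<delta> \<le> Q powr (2 * \<delta>)" .
  have "real (E4 r j U U) \<le> C * U powr (2 - \<nu>') * U ^ 2 * (U ^ 3 * U ^ 2 / real r + U * U) * real r powr \<delta>"
    by (rule E)
  also have "\<dots> \<le> C * (9 * Q powr (1 - \<nu> / 2 + 2 * \<delta>)) * (9 * Q powr (1 + 2 * \<delta>)) *
      (243 * Q powr (1 + 6 * \<delta>) + 9 * Q powr (1 + 6 * \<delta>)) * Q powr (2 * \<delta>)"
    using C U1 r0 by (intro mult_mono e1 eq_refl[OF e2] add_mono[OF e3 e4] e5 order_refl mult_nonneg_nonneg) auto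
  also have "\<dots> = C * 20412 * (Q powr (1 - \<nu> / 2 + 2 * \<delta>) * Q powr (1 + 2 * \<delta>) * Q powr (1 + 6 * \<delta>) * Q powr (2 * \<delta>))"
    by (simp add: algebra_simps)
  also have "\<dots> = C * 20412 * Q powr (3 - \<nu> / 2 + 12 * \<delta>)"
  proof -
    have "3 - \<nu> / 2 + 12 * \<delta> = (1 - \<nu> / 2 + 2 * \<delta>) + (1 + 2 * \<delta>) + (1 + 6 * \<delta>) + 2 * \<delta>" by simp
    then show ?thesis by (simp only: powr_add)
  qed
  \<comment> \<open>With \<open>\<delta> = \<nu> / 40\<close> the losses
    \<open>12 * \<delta>\<close> use up \<open>3 \<nu> / 10\<close> of the saving
    \<open>\<nu> / 2\<close>.\<close>
  also have "3 - \<nu> / 2 + 12 * \<delta> = 3 - \<nu> / 5" by (simp add: \<delta>)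
  finally show ?thesis .
qed

theorem near_fractions_bound:
  assumes "\<nu>' > 0" "energy_bound \<nu>'"
  obtains \<eta> C where "\<eta> > 0" "C > 0"
    "\<And>Q \<alpha>. Q \<ge> 1 \<Longrightarrow> real (card (near_fractions Q \<alpha>)) \<le> C * Q powr (1/2 - \<eta>)"
proof -
  define \<nu> where "\<nu> = min \<nu>' 1"
  \<comment> \<open>The saving in the energy case must survive an eighth root,
    \<open>4 - \<nu> / 5 \<le> 8 * (1/2 - \<eta>)\<close>, and for small \<open>r\<close> the saving
    \<open>\<delta>\<close> must pay for \<open>\<tau>^2\<close>;
    \<open>\<eta> = \<delta> / 2\<close> meets both.\<close>
  define \<delta> where "\<delta> = \<nu> / 40"
  define \<eta> where "\<eta> = \<nu> / 80"
  have \<nu>: "0 < \<nu>" "\<nu> \<le> \<nu>'" "\<nu> \<le> 1" using assms by (auto simp: \<nu>_def)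
  then have \<delta>: "\<delta> > 0" "\<delta> \<le> 1/40" "\<eta> > 0" "\<eta> \<le> 1/80" and \<eta>\<delta>: "\<eta> = \<delta> / 2"
    by (auto simp: \<delta>_def \<eta>_def)
  \<comment> \<open>Since \<open>r \<le> Q^2\<close>, the exponent \<open>\<delta> / 8\<close> makes
    \<open>\<tau>^2\<close> cost only \<open>Q powr (\<delta> / 2)\<close>.\<close>
  obtain D where D: "D \<ge> 1" "\<And>n. n > 0 \<Longrightarrow> real (card {d. d dvd n}) \<le> D * real n powr (\<delta> / 8)"
    using card_divisors_le_powr[of "\<delta> / 8"] \<delta> by auto
  obtain C1 where C1: "\<And>r j M H. r \<ge> 1 \<Longrightarrow> j \<ge> 1 \<Longrightarrow> coprime r j \<Longrightarrow> 1 \<le> H \<Longrightarrow> H \<le> M \<Longrightarrow> M \<le> real r \<Longrightarrow>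
         real (E4 r j M H) \<le> C1 * H powr (2 - \<nu>') * M ^ 2 * (H ^ 3 * M ^ 2 / real r + H * M) * real r powr \<delta>"
    using assms(2) \<delta>(1) unfolding energy_bound_def by metis
  \<comment> \<open>The sign of \<open>C1\<close> is unknown; raising it to at least 1 allows
    monotone estimates and gives \<open>A \<ge> 1\<close>.\<close>
  define C2 where "C2 = max C1 1"
  have C2: "real (E4 r j M H) \<le> C2 * H powr (2 - \<nu>') * M ^ 2 * (H ^ 3 * M ^ 2 / real r + H * M) * real r powr \<delta>"
    if "r \<ge> 1" "j \<ge> 1" "coprime r j" "1 \<le> H" "H \<le> M" "M \<le> real r" for r j M H
  proof -
    have "C1 * (H powr (2 - \<nu>') * M ^ 2 * (H ^ 3 * M ^ 2 / real r + H * M) * real r powr \<delta>)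
      \<le> C2 * (H powr (2 - \<nu>') * M ^ 2 * (H ^ 3 * M ^ 2 / real r + H * M) * real r powr \<delta>)"
      using that by (intro mult_right_mono) (auto simp: C2_def)
    then show ?thesis using C1[OF that] by (simp only: mult.assoc) 
  qed
  define A where "A = 80 * (C2 * 20412)"
  have A1: "A \<ge> 1" by (simp add: A_def C2_def)
  define C where "C = 64 + 48 * D\<^sup>2 + 64 * D + 2 * A"
  have small: "real (card (near_fractions Q \<alpha>)) \<le> 64 * Q powr (1/2 - \<eta>)" if Q: "1 \<le> Q" "Q < 16" for Q \<alpha>
  proof -
    have "real (card (near_fractions Q \<alpha>)) \<le> 64 * 1" using card_near_fractions_le[OF Q(1), of \<alpha>] Q by simp
    also have "\<dots> \<le> 64 * Q powr (1/2 - \<eta>)" using Q \<delta> by (intro mult_left_mono ge_one_powr_ge_zero) auto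
    finally show ?thesis .
  qed
  have large: "real (card (near_fractions Q \<alpha>)) \<le> (1 + 48 * D\<^sup>2 + 64 * D + 2 * A) * Q powr (1/2 - \<eta>)"
    if Q: "Q \<ge> 16" for Q \<alpha>
  proof -
    define X where "X = Q powr (1/2 - \<eta>)"
    have Q1: "Q \<ge> 1" "Q > 0" using Q by auto
    have X1: "X \<ge> 1" unfolding X_def using Q1 \<delta> by (intro ge_one_powr_ge_zero) auto
    have "Q powr (3/2 + \<delta>) \<ge> 1" using Q1 \<delta> by (intro ge_one_powr_ge_zero) auto
    then obtain b :: int and r :: nat where br: "r > 0" "coprime b (int r)" "real r \<le> Q powr (3/2 + \<delta>)"
      "real r * \<bar>\<alpha> - b / r\<bar> \<le> 2 / Q powr (3/2 + \<delta>)"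
      using diophantine_approximation_exists[of "Q powr (3/2 + \<delta>)" \<alpha>] by blast
    interpret diophantine_approximation Q \<alpha> b r by unfold_locales (use Q1 br in auto)
    have "\<tau> \<le> D * real r powr (\<delta> / 8)" using D(2) br(1) by blast
    also have "\<dots> \<le> D * (Q powr (3/2 + \<delta>)) powr (\<delta> / 8)"
      using br D(1) \<delta> by (intro mult_left_mono powr_mono2) auto
    also have "\<dots> = D * Q powr ((3/2 + \<delta>) * (\<delta> / 8))" by (simp add: powr_powr)
    also have "\<dots> \<le> D * Q powr (\<delta> / 4)"
    proof (intro mult_left_mono powr_mono)
      have "(3/2 + \<delta>) * (\<delta> / 8) \<le> 2 * (\<delta> / 8)" using \<delta> by (intro mult_right_mono) auto
      then show "(3/2 + \<delta>) * (\<delta> / 8) \<le> \<delta> / 4" by simp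
    qed (use D(1) Q1 in auto)
    finally have \<tau>: "\<tau> \<le> D * Q powr (\<delta> / 4)" .
    have "\<tau>\<^sup>2 \<le> (D * Q powr (\<delta> / 4))\<^sup>2" using \<tau> by (intro power_mono) auto
    also have "\<dots> = D\<^sup>2 * Q powr (\<delta> / 2)"
      by (simp add: power2_eq_square powr_add[symmetric] mult_ac)
    finally have \<tau>2: "\<tau>\<^sup>2 \<le> D\<^sup>2 * Q powr (\<delta> / 2)" .
    \<comment> \<open>The first term comes from the error of the Dirichlet approximation, the second
      from the window \<open>1 / Q^3\<close>. Which one dominates depends on \<open>r\<close>,
      whence the case distinction.\<close>
    have res: "\<bar>real_of_int (residual p)\<bar> \<le> 2 * Q powr (1/2 - \<delta>) + real r / Q" if "p \<in> near_fractions Q \<alpha>" for p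
    proof -
      have "\<bar>real_of_int (residual p)\<bar> \<le> real r * Q\<^sup>2 * (\<bar>z\<bar> + 1 / Q ^ 3)" by (rule abs_residual_le[OF that])
      also have "\<dots> = Q\<^sup>2 * (real r * \<bar>z\<bar>) + real r / Q"
        using Q1 by (simp add: field_simps power2_eq_square power3_eq_cube)
      also have "\<dots> \<le> Q\<^sup>2 * (2 / Q powr (3/2 + \<delta>)) + real r / Q"
        using br(4) by (intro add_right_mono mult_left_mono) auto
      also have "Q\<^sup>2 * (2 / Q powr (3/2 + \<delta>)) = 2 * (Q powr 2 / Q powr (3/2 + \<delta>))"
        using Q1 by (simp add: powr_numeral)
      also have "\<dots> = 2 * Q powr (1/2 - \<delta>)" by (simp add: powr_diff[symmetric])
      finally show ?thesis .
    qed
    have rQ: "real r / Q \<le> Q powr (s - 1)" if "real r \<le> Q powr s" for s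
      using that Q1 by (simp add: powr_diff divide_right_mono)
    show ?thesis
    proof (cases "real r \<le> Q powr (3/2 - \<delta>)")
      case True
      define U where "U = 3 * Q powr (1/2 - \<delta>)"
      have U: "\<bar>real_of_int (residual p)\<bar> \<le> U" if "p \<in> near_fractions Q \<alpha>" for p
        using res[OF that] rQ[OF True] by (simp add: U_def)
      have part: "real (card (signed_part \<sigma>)) \<le> 24 * D\<^sup>2 * X" if "\<sigma> \<in> {1, - 1}" for \<sigma>
      proof -
        have "real (card (signed_part \<sigma>)) \<le> 8 * U * \<tau>\<^sup>2"
          using card_signed_part_le[OF that U] by (simp add: U_def)
        also have "\<dots> \<le> 8 * U * (D\<^sup>2 * Q powr (\<delta> / 2))"
          using \<tau>2 by (intro mult_left_mono) (auto simp: U_def)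
        also have "\<dots> = 24 * D\<^sup>2 * (Q powr (1/2 - \<delta>) * Q powr (\<delta> / 2))" by (simp add: U_def)
        also have "\<dots> = 24 * D\<^sup>2 * X" by (simp add: X_def \<eta>\<delta> powr_add[symmetric])
        finally show ?thesis .
      qed
      have "real (card (near_fractions Q \<alpha>)) \<le> 1 * X + 24 * D\<^sup>2 * X + 24 * D\<^sup>2 * X"
        using card_near_fractions_split part[OF insertI1] part[OF insertI2[OF singletonI]] X1 by linarith
      also have "\<dots> = (1 + 48 * D\<^sup>2) * X" by (simp add: algebra_simps)
      also have "\<dots> \<le> (1 + 48 * D\<^sup>2 + 64 * D + 2 * A) * X" using D(1) A1 X1 by (intro mult_right_mono) auto
      finally show ?thesis unfolding X_def .
    next
      case False
      define U where "U = 3 * Q powr (1/2 + \<delta>)"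
      have "Q powr (1/2 - \<delta>) \<le> Q powr (1/2 + \<delta>)" using Q1 \<delta> by (intro powr_mono) auto
      then have U: "\<bar>real_of_int (residual p)\<bar> \<le> U" if "p \<in> near_fractions Q \<alpha>" for p
        using res[OF that] rQ[OF br(3)] by (simp add: U_def)
      have U1: "U \<ge> 1" using ge_one_powr_ge_zero[of Q "1/2 + \<delta>"] Q1 \<delta> by (simp add: U_def)
      have "Q powr 1 \<le> Q powr (3/2 - \<delta>)" using Q1 \<delta> by (intro powr_mono) auto
      then have Qr: "Q < real r" using False Q1 by simp
      \<comment> \<open>The threshold 16 absorbs the constant 3 of \<open>U\<close>, giving
        \<open>U \<le> r\<close> as the energy bound demands.\<close>
      have "(3::real) \<le> 16 powr (1/2)" by (simp add: powr_half_sqrt real_le_rsqrt)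
      also have "\<dots> \<le> Q powr (1/2)" using Q by (intro powr_mono2) auto
      also have "\<dots> \<le> Q powr (1 - 2 * \<delta>)" using Q1 \<delta> by (intro powr_mono) auto
      finally have "U \<le> Q powr (1 - 2 * \<delta>) * Q powr (1/2 + \<delta>)" unfolding U_def by (intro mult_right_mono) auto
      also have "\<dots> = Q powr (3/2 - \<delta>)" by (simp add: powr_add[symmetric])
      finally have Ur: "U \<le> real r" using False by simp
      have part: "real (card (signed_part \<sigma>)) \<le> (32 * D + A) * X" if \<sigma>: "\<sigma> \<in> {1, - 1}" for \<sigma>
      \<comment> \<open>Either the fractions are numerous enough that no single residual dominates
        and the energy bound applies, or their number is at most about
        \<open>Q powr (1/4 + 3 * \<delta> / 4)\<close>, well below \<open>X\<close>.\<close>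
      proof (cases "16 * sqrt U * \<tau> \<le> real (card (signed_part \<sigma>))")
        case True
        then obtain j where j: "j \<ge> 1" "coprime r j"
          "real (card (signed_part \<sigma>)) ^ 8 \<le> 16 * (4 * Q + 1) * real (E4 r j U U)"
          using signed_part_energy[OF \<sigma> U] U1 Qr by auto
        have E: "real (E4 r j U U) \<le> C2 * 20412 * Q powr (3 - \<nu> / 5)"
          by (rule E4_le_powr[OF \<nu> \<delta>_def _ Q _ br(3) U_def C2])
            (use False j br U1 Ur in \<open>auto simp: C2_def\<close>)
        note j(3)
        also have "16 * (4 * Q + 1) * real (E4 r j U U) \<le> (80 * Q) * (C2 * 20412 * Q powr (3 - \<nu> / 5))"
        proof (rule mult_mono[OF _ E])
          show "16 * (4 * Q + 1) \<le> 80 * Q" using Q1 by simp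
        qed (use Q1 in auto)
        also have "\<dots> = A * (Q powr 1 * Q powr (3 - \<nu> / 5))" using Q1 by (simp add: A_def)
        also have "Q powr 1 * Q powr (3 - \<nu> / 5) = Q powr (4 - \<nu> / 5)" by (subst powr_add[symmetric]) simp
        \<comment> \<open>The right side is enlarged to an exact eighth power, using
          \<open>A \<ge> 1\<close> and \<open>8 * \<eta> = \<nu> / 10\<close>.\<close>
        also have "A * Q powr (4 - \<nu> / 5) \<le> A ^ 8 * Q powr (8 * (1/2 - \<eta>))"
          using A1 Q1 \<nu> by (intro mult_mono powr_mono self_le_power) (auto simp: \<eta>_def)
        also have "Q powr (8 * (1/2 - \<eta>)) = X ^ 8"
          using Q1 unfolding X_def by (simp add: powr_powr powr_realpow[symmetric] mult.commute)
        also have "A ^ 8 * X ^ 8 = (A * X) ^ 8" by (simp add: power_mult_distrib)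
        finally have "real (card (signed_part \<sigma>)) \<le> A * X"
          by (rule power_le_imp_le_base[of _ 7, simplified]) (use A1 X1 in auto)
        also have "\<dots> \<le> (32 * D + A) * X" using D(1) X1 by (intro mult_right_mono) auto
        finally show ?thesis .
      next
        case False
        have sU: "sqrt U \<le> 2 * Q powr (1/4 + \<delta> / 2)"
        proof (rule real_le_lsqrt)
          have "(2 * Q powr (1/4 + \<delta> / 2))\<^sup>2 = 4 * Q powr (1/2 + \<delta>)"
            by (simp add: power2_eq_square powr_add[symmetric])
          then show "U \<le> (2 * Q powr (1/4 + \<delta> / 2))\<^sup>2" by (simp add: U_def)
        qed simp
        have "real (card (signed_part \<sigma>)) \<le> 16 * sqrt U * \<tau>" using False by simp
        also have "\<dots> \<le> 16 * (2 * Q powr (1/4 + \<delta> / 2)) * (D * Q powr (\<delta> / 4))"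
          using sU \<tau> U1 by (intro mult_mono) auto
        also have "\<dots> = 32 * D * (Q powr (1/4 + \<delta> / 2) * Q powr (\<delta> / 4))" by simp
        also have "\<dots> = 32 * D * Q powr (1/4 + \<delta> / 2 + \<delta> / 4)" by (simp only: powr_add)
        also have "\<dots> \<le> 32 * D * X"
          unfolding X_def using Q1 \<delta> D(1) by (intro mult_left_mono powr_mono) auto
        also have "\<dots> \<le> (32 * D + A) * X" using A1 X1 by (intro mult_right_mono) auto
        finally show ?thesis .
      qed
      have "real (card (near_fractions Q \<alpha>)) \<le> 1 * X + (32 * D + A) * X + (32 * D + A) * X"
        using card_near_fractions_split part[OF insertI1] part[OF insertI2[OF singletonI]] X1 by linarith
      also have "\<dots> = (1 + 64 * D + 2 * A) * X" by (simp add: algebra_simps)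
      also have "\<dots> \<le> (1 + 48 * D\<^sup>2 + 64 * D + 2 * A) * X" using X1 by (intro mult_right_mono) auto
      finally show ?thesis unfolding X_def .
    qed
  qed
  show ?thesis
  proof (rule that[OF \<delta>(3)])
    show "C > 0" using D(1) A1 by (simp add: C_def add_nonneg_pos)
    fix Q \<alpha> :: real assume Q: "Q \<ge> 1"
    show "real (card (near_fractions Q \<alpha>)) \<le> C * Q powr (1/2 - \<eta>)"
    proof (cases "Q < 16")
      case True
      then have "real (card (near_fractions Q \<alpha>)) \<le> 64 * Q powr (1/2 - \<eta>)" using small Q by blast
      also have "\<dots> \<le> C * Q powr (1/2 - \<eta>)" using D(1) A1 by (intro mult_right_mono) (auto simp: C_def)
      finally show ?thesis .
    next
      case False
      then have "real (card (near_fractions Q \<alpha>)) \<le> (1 + 48 * D\<^sup>2 + 64 * D + 2 * A) * Q powr (1/2 - \<eta>)" using large by simp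
      also have "\<dots> \<le> C * Q powr (1/2 - \<eta>)" by (intro mult_right_mono) (auto simp: C_def)
      finally show ?thesis .
    qed
  qed
qed

section \<open>From Farey fractions modulo 1 to the large sieve inequality\<close>

definition farey_square_indices :: "real \<Rightarrow> (nat \<times> nat) set" where
  "farey_square_indices Q = (SIGMA q:{q. 1 \<le> q \<and> real q \<le> Q}. {b \<in> {1..q\<^sup>2}. gcd q b = 1})"

lemma finite_nat_le_real: "finite {q::nat. 1 \<le> q \<and> real q \<le> Q}"
  by (rule finite_subset[of _ "{..nat \<lfloor>Q\<rfloor>}"]) (auto simp: le_nat_floor)

lemma finite_farey_square_indices: "finite (farey_square_indices Q)"
  unfolding farey_square_indices_def by (intro finite_SigmaI finite_nat_le_real) auto

text \<open>Subtracting a suitable integer \<open>l\<close> from \<open>b / q^2\<close> moves it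
  near \<open>\<beta>\<close> on the real line; \<open>b\<close> changes by a multiple of
  \<open>q^2\<close>, so coprimality persists. The map is injective because \<open>b\<close> runs
  through one complete residue system modulo \<open>q^2\<close>.\<close>

lemma card_farey_square_near_le:
  fixes Q \<beta> :: real and L :: nat
  assumes Q: "Q \<ge> 1" and L: "Q ^ 3 \<le> real L"
  shows "card {i \<in> farey_square_indices Q. \<exists>l::int. \<bar>real (snd i) / real ((fst i)\<^sup>2) - \<beta> - of_int l\<bar> \<le> 1 / real L}
    \<le> card (near_fractions Q \<beta>)" (is "card ?A \<le> _")
proof -
  have Q3: "Q ^ 3 > 0" using Q by simp
  then have LQ: "1 / real L \<le> 1 / Q ^ 3" using L by (intro frac_le) auto
  define l where "l i = (SOME l::int. \<bar>real (snd i) / real ((fst i)\<^sup>2) - \<beta> - of_int l\<bar> \<le> 1 / real L)" for i :: "nat \<times> nat"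
  define \<phi> where "\<phi> i = (int (fst i), int (snd i) - l i * (int (fst i))\<^sup>2)" for i :: "nat \<times> nat"
  have l: "\<bar>real (snd i) / real ((fst i)\<^sup>2) - \<beta> - of_int (l i)\<bar> \<le> 1 / real L" if "i \<in> ?A" for i
    using that unfolding l_def by (auto intro: someI_ex)
  have "\<phi> ` ?A \<subseteq> near_fractions Q \<beta>"
  proof
    fix p assume "p \<in> \<phi> ` ?A"
    then obtain i where i: "i \<in> ?A" "p = \<phi> i" by blast
    obtain q b where qb: "i = (q, b)" by (cases i)
    have q: "1 \<le> q" "real q \<le> Q" "gcd q b = 1" using i qb by (auto simp: farey_square_indices_def)
    have "\<bar>real b / (real q)\<^sup>2 - \<beta> - of_int (l i)\<bar> \<le> 1 / Q ^ 3" using l[OF i(1)] LQ qb by simp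
    moreover have "real b / (real q)\<^sup>2 - of_int (l i) = (real b - of_int (l i) * (real q)\<^sup>2) / (real q)\<^sup>2"
      using q by (simp add: field_simps)
    ultimately have "\<bar>(real b - of_int (l i) * (real q)\<^sup>2) / (real q)\<^sup>2 - \<beta>\<bar> \<le> 1 / Q ^ 3"
      by (smt (verit))
    moreover have "coprime (int q) (int b - l i * (int q)\<^sup>2)"
    proof -
      have "gcd (int q) (int b + (- l i * int q) * int q) = gcd (int q) (int b)"
        by (metis gcd_add_mult add.commute)
      then show ?thesis using q(3) by (simp add: coprime_iff_gcd_eq_1 power2_eq_square mult_ac)
    qed
    ultimately show "p \<in> near_fractions Q \<beta>"
      using q unfolding i(2) \<phi>_def near_fractions_def qb by simp
  qed
  moreover have "inj_on \<phi> ?A"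
  proof (rule inj_onI)
    fix i i' assume ii: "i \<in> ?A" "i' \<in> ?A" "\<phi> i = \<phi> i'"
    obtain q b q' b' where qb: "i = (q, b)" "i' = (q', b')" by (cases i, cases i')
    have qq: "q' = q" using ii(3) qb by (simp add: \<phi>_def)
    have "int b - l i * (int q)\<^sup>2 = int b' - l i' * (int q)\<^sup>2" using ii(3) qb qq by (simp add: \<phi>_def)
    then have "int b - int b' = (l i - l i') * (int q)\<^sup>2" by (simp add: algebra_simps)
    then have "(int q)\<^sup>2 dvd int b - int b'" by simp
    moreover have "b \<in> {1..q\<^sup>2}" "b' \<in> {1..q\<^sup>2}" using ii qb qq by (auto simp: farey_square_indices_def)
    then have "\<bar>int b - int b'\<bar> < (int q)\<^sup>2" by (auto simp flip: of_nat_power)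
    ultimately have "int b - int b' = 0" by (meson dvd_imp_le_int not_less abs_of_nonneg zero_le_power2 zdvd_not_zless dvd_abs_iff zero_less_abs_iff)
    then show "i = i'" using qb qq by simp
  qed
  ultimately show ?thesis using finite_near_fractions[OF Q] by (meson card_inj_on_le)
qed

theorem theorem1p9:
  assumes "\<exists>\<nu>::real. \<nu> > 0 \<and>
    (\<forall>\<epsilon>::real. \<epsilon> > 0 \<longrightarrow>
      (\<exists>C::real. \<forall>(r::nat) (j::nat) (M::real) (H::real).
         r \<ge> 1 \<longrightarrow> j \<ge> 1 \<longrightarrow> coprime r j \<longrightarrow> 1 \<le> H \<longrightarrow> H \<le> M \<longrightarrow> M \<le> real r \<longrightarrow>
         real (E4 r j M H) \<le>
           C * H powr (2 - \<nu>) * M ^ 2 * (H ^ 3 * M ^ 2 / real r + H * M) * real r powr \<epsilon>))"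
  shows "\<exists>\<eta>::real. \<eta> > 0 \<and>
    (\<exists>C::real. C > 0 \<and>
      (\<forall>(Q::real) (N::real) (M::real) (a::int \<Rightarrow> complex).
         Q \<ge> 1 \<longrightarrow> N = Q ^ 3 \<longrightarrow>
         (\<Sum>q\<in>{q::nat. 1 \<le> q \<and> real q \<le> Q}. \<Sum>b\<in>{b\<in>{1..q ^ 2}. gcd q b = 1}.
            (cmod (\<Sum>n\<in>{n::int. M < real_of_int n \<and> real_of_int n \<le> M + N}.
               a n * e (real_of_int n * real b / real (q ^ 2)))) ^ 2)
         \<le> C * Q powr (1 / 2 - \<eta>) * N *
             (\<Sum>n\<in>{n::int. M < real_of_int n \<and> real_of_int n \<le> M + N}. (cmod (a n)) ^ 2)))"
proof -
  obtain \<nu> where \<nu>: "\<nu> > 0" "energy_bound \<nu>" using assms unfolding energy_bound_def by blast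
  obtain \<eta> C where \<eta>: "\<eta> > 0" and C: "C > 0"
    and count: "\<And>Q \<alpha>. Q \<ge> 1 \<Longrightarrow> real (card (near_fractions Q \<alpha>)) \<le> C * Q powr (1/2 - \<eta>)"
    using near_fractions_bound[OF \<nu>] by blast
  have main: "(\<Sum>q\<in>{q::nat. 1 \<le> q \<and> real q \<le> Q}. \<Sum>b\<in>{b\<in>{1..q ^ 2}. gcd q b = 1}.
            (cmod (\<Sum>n\<in>{n::int. M < real_of_int n \<and> real_of_int n \<le> M + N}.
               a n * e (real_of_int n * real b / real (q ^ 2)))) ^ 2)
         \<le> (16 * C) * Q powr (1 / 2 - \<eta>) * N *
             (\<Sum>n\<in>{n::int. M < real_of_int n \<and> real_of_int n \<le> M + N}. (cmod (a n)) ^ 2)"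
    if Q: "Q \<ge> 1" and N: "N = Q ^ 3" for Q N M :: real and a :: "int \<Rightarrow> complex"
  proof -
    define I where "I = {n::int. M < real_of_int n \<and> real_of_int n \<le> M + N}"
    \<comment> \<open>The sieve works with an integer length. As \<open>N \<ge> 1\<close>, rounding
      up gives \<open>L \<le> 2 * N\<close>, which turns the sieve constant 8 into 16.\<close>
    define L where "L = nat \<lceil>N\<rceil>"
    define Z where "Z = (\<Sum>n\<in>I. (cmod (a n)) ^ 2)"
    define K where "K = C * Q powr (1/2 - \<eta>)"
    have Z0: "Z \<ge> 0" by (simp add: Z_def sum_nonneg)
    have N1: "N \<ge> 1" using Q by (simp add: N)
    have NL: "N \<le> real L" "real L \<le> 2 * N" "L > 0" unfolding L_def using N1 by linarith+
    have K0: "K \<ge> 0" using C by (simp add: K_def)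
    have I: "I \<subseteq> {\<lfloor>M\<rfloor> + 1..<\<lfloor>M\<rfloor> + 1 + int L}"
    proof
      fix n assume "n \<in> I"
      then have "M < real_of_int n" "real_of_int n \<le> M + N" by (auto simp: I_def)
      moreover have "real_of_int n < real_of_int (\<lfloor>M\<rfloor> + 1 + int L)"
        using calculation NL(1) by simp linarith
      moreover have "\<lfloor>M\<rfloor> < n" using calculation(1) by (simp add: floor_less_iff)
      ultimately show "n \<in> {\<lfloor>M\<rfloor> + 1..<\<lfloor>M\<rfloor> + 1 + int L}"
        unfolding of_int_less_iff by simp
    qed
    have cnt: "real (card {i \<in> farey_square_indices Q. \<exists>l::int. \<bar>real (snd i) / real ((fst i)\<^sup>2) - \<beta> - of_int l\<bar> \<le> 1 / real L}) \<le> K" for \<beta>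
      using card_farey_square_near_le[OF Q, of L \<beta>] count[OF Q, of \<beta>] NL(1) unfolding K_def N by linarith
    have "(\<Sum>q\<in>{q::nat. 1 \<le> q \<and> real q \<le> Q}. \<Sum>b\<in>{b\<in>{1..q ^ 2}. gcd q b = 1}.
            (cmod (\<Sum>n\<in>I. a n * e (real_of_int n * real b / real (q ^ 2)))) ^ 2)
        = (\<Sum>i\<in>farey_square_indices Q. (cmod (\<Sum>n\<in>I. a n * e (real_of_int n * (real (snd i) / real ((fst i)\<^sup>2))))) ^ 2)"
      unfolding farey_square_indices_def using finite_nat_le_real
      by (subst sum.Sigma) (auto simp: split_beta)
    also have "\<dots> \<le> 8 * K * L * Z"
      unfolding Z_def by (rule large_sieve[OF finite_farey_square_indices NL(3) K0 cnt I])
    also have "\<dots> \<le> 8 * K * (2 * N) * Z"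
      using NL(2) K0 Z0 by (intro mult_right_mono mult_left_mono) auto
    also have "\<dots> = (16 * C) * Q powr (1 / 2 - \<eta>) * N * Z" by (simp add: K_def)
    finally show ?thesis unfolding I_def Z_def .
  qed
  have "16 * C > 0" using C by simp
  with \<eta> main show ?thesis by blast
qed

end
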